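(* Let $\alpha,\beta,\gamma>-1$ with $\alpha+\gamma+\frac32>0$ and $\beta+\gamma+\frac32>0$. For all admissible parameters, let $\{P_{k,n}^{\alpha,\beta,\gamma}:0\le k\le n\}$ denote an orthonormal basis of $\mathcal{V}_n(W_{\alpha,\beta,\gamma})$. Then for $n=0,1,\ldots$, an orthonormal basis of $\mathcal{V}_{2n}(\mathcal{W}_{\alpha,\beta,\gamma})$ is given by $${}_1Q_{k,2n}^{\alpha,\beta,\gamma}(x,y)=P_{k,n}^{\alpha,\beta,\gamma}(2xy,x^2+y^2-1),\quad 0\le k\le n,$$ $${}_2Q_{k,2n}^{\alpha,\beta,\gamma}(x,y)=b_{\alpha,\beta,\gamma}^{(1,1)}(x^2-y^2)P_{k,n-1}^{\alpha+1,\beta+1,\gamma}(2xy,x^2+y^2-1),\quad 0\le k\le n-1,$$ and an orthonormal basis of $\mathcal{V}_{2n+1}(\mathcal{W}_{\alpha,\beta,\gamma})$ is given by $${}_1Q_{k,2n+1}^{\alpha,\beta,\gamma}(x,y)=b_{\alpha,\beta,\gamma}^{(0,1)}(x+y)P_{k,n}^{\alpha,\beta+1,\gamma}(2xy,x^2+y^2-1),\quad 0\le k\le n,$$ $${}_2Q_{k,2n+1}^{\alpha,\beta,\gamma}(x,y)=b_{\alpha,\beta,\gamma}^{(1,0)}(x-y)P_{k,n}^{\alpha+1,\beta,\gamma}(2xy,x^2+y^2-1),\quad 0\le k\le n,$$ where $b_{\alpha,\beta,\gamma}^{(i,j)}=\sqrt{a_{\alpha+i,\beta+j,\gamma}/a_{\alpha,\beta,\gamma}}$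 for $i,j=0,1$.
   Context: Let $\Omega=\{(u,v):1+u+v>0,\;1-u+v>0,\;u^2>4v\}$. The normalized Koornwinder weight on $\Omega$ is $$W_{\alpha,\beta,\gamma}(u,v)=2a_{\alpha,\beta,\gamma}(1-u+v)^\alpha(1+u+v)^\beta(u^2-4v)^\gamma,$$ where $$a_{\alpha,\beta,\gamma}=\frac{\sqrt\pi}{2^{2\alpha+2\beta+4\gamma+4}}\,\frac{\Gamma(\alpha+\beta+\gamma+\frac52)\Gamma(\alpha+\beta+2\gamma+3)}{\Gamma(\alpha+1)\Gamma(\beta+1)\Gamma(\gamma+1)\Gamma(\alpha+\gamma+\frac32)\Gamma(\beta+\gamma+\frac32)}$$ is the constant making $\int_\Omega W_{\alpha,\beta,\gamma}=1$ (the admissible parameters are those satisfying the inequalities in the claim, which ensure integrability). On $[-1,1]^2$, $$\mathcal{W}_{\alpha,\beta,\gamma}(x,y)=2a_{\alpha,\beta,\gamma}4^\gamma|x-y|^{2\alpha+1}|x+y|^{2\beta+1}(1-x^2)^\gamma(1-y^2)^\gamma .$$ For a weight $W$ on a domain $D\subset\mathbb{R}^2$, $\langle f,g\rangle_W=\int_Dfg\,W$; $\mathcal{V}_n(W)$ is the $(n+1)$-dimensional space of polynomials of total degree at most $n$ in two variables orthogonal (in $\langle\cdot,\cdot\rangle_W$) to all polynomials of total degree at most $n-1$. Orthonormality is with respect to $\langle\cdot,\cdot\rangle_W$.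
   Formalization: The region Ω is taken with the extra condition |u|<2: the three stated inequalities also hold on two unbounded components, where polynomials are not integrable against W and the stated normalization ∫W=1 fails; the bounded component is the intended domain. *)

theory Defs
  imports "HOL-Analysis.Analysis" "HOL-Library.Function_Algebras"
begin

text \<open>Real-valued functions as a real vector space, with the pointwise operations.\<close>

global_interpretation fun_space:
  vector_space "\<lambda>(c::real) (f::'a \<Rightarrow> real) x. c * f x"
  by unfold_locales (simp_all add: fun_eq_iff algebra_simps)

text \<open>Polynomial functions in two variables of total degree at most \<open>n\<close>.\<close>

definition poly_space :: "nat \<Rightarrow> (real \<times> real \<Rightarrow> real) set" where
  "poly_space n = fun_space.span {(\<lambda>(x, y). x ^ i * y ^ j) | i j. i + j \<le> n}"

definition weighted_inner ::
  "(real \<times> real) set \<Rightarrow> (real \<times> real \<Rightarrow> real) \<Rightarrow>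
   (real \<times> real \<Rightarrow> real) \<Rightarrow> (real \<times> real \<Rightarrow> real) \<Rightarrow> real" where
  "weighted_inner D W f g = set_lebesgue_integral lborel D (\<lambda>p. f p * g p * W p)"

text \<open>For \<open>n = 0\<close> the orthogonality condition is void, so this is the space of constants.\<close>

definition orth_poly_space ::
  "(real \<times> real) set \<Rightarrow> (real \<times> real \<Rightarrow> real) \<Rightarrow> nat \<Rightarrow> (real \<times> real \<Rightarrow> real) set" where
  "orth_poly_space D W n =
     {f \<in> poly_space n. \<forall>m<n. \<forall>g \<in> poly_space m. weighted_inner D W f g = 0}"

definition orthonormal_basis ::
  "(real \<times> real) set \<Rightarrow> (real \<times> real \<Rightarrow> real) \<Rightarrow> (real \<times> real \<Rightarrow> real) set \<Rightarrow>
   'i set \<Rightarrow> ('i \<Rightarrow> real \<times> real \<Rightarrow> real) \<Rightarrow> bool" where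
  "orthonormal_basis D W V I Q \<longleftrightarrow>
     inj_on Q I \<and> fun_space.independent (Q ` I) \<and> fun_space.span (Q ` I) = V \<and>
     (\<forall>i\<in>I. \<forall>j\<in>I. weighted_inner D W (Q i) (Q j) = (if i = j then 1 else 0))"

definition admissible :: "real \<Rightarrow> real \<Rightarrow> real \<Rightarrow> bool" where
  "admissible \<alpha> \<beta> \<gamma> \<longleftrightarrow>
     \<alpha> > -1 \<and> \<beta> > -1 \<and> \<gamma> > -1 \<and> \<alpha> + \<gamma> + 3/2 > 0 \<and> \<beta> + \<gamma> + 3/2 > 0"

text \<open>
  The region bounded by the two lines \<open>1 \<plusminus> u + v = 0\<close> and the parabola \<open>u\<^sup>2 = 4 v\<close>.
  The lines are tangent to the parabola at \<open>(\<plusminus>2, 1)\<close>, so the three inequalities usually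
  quoted for it also hold on two unbounded components with \<open>\<bar>u\<bar> > 2\<close>, over which the
  weight times a polynomial is in general not integrable. The condition \<open>\<bar>u\<bar> < 2\<close> selects
  the intended bounded component, which is the one on which the weight has integral 1.
\<close>

definition Koornwinder_region :: "(real \<times> real) set" where
  "Koornwinder_region =
     {(u, v). 1 + u + v > 0 \<and> 1 - u + v > 0 \<and> u\<^sup>2 > 4 * v \<and> \<bar>u\<bar> < 2}"

definition norm_const :: "real \<Rightarrow> real \<Rightarrow> real \<Rightarrow> real" where
  "norm_const \<alpha> \<beta> \<gamma> =
     sqrt pi / 2 powr (2 * \<alpha> + 2 * \<beta> + 4 * \<gamma> + 4) *
     ((Gamma (\<alpha> + \<beta> + \<gamma> + 5/2) * Gamma (\<alpha> + \<beta> + 2 * \<gamma> + 3)) /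
      (Gamma (\<alpha> + 1) * Gamma (\<beta> + 1) * Gamma (\<gamma> + 1) *
       Gamma (\<alpha> + \<gamma> + 3/2) * Gamma (\<beta> + \<gamma> + 3/2)))"

definition Koornwinder_weight :: "real \<Rightarrow> real \<Rightarrow> real \<Rightarrow> real \<times> real \<Rightarrow> real" where
  "Koornwinder_weight \<alpha> \<beta> \<gamma> = (\<lambda>(u, v).
     2 * norm_const \<alpha> \<beta> \<gamma> *
     (1 - u + v) powr \<alpha> * (1 + u + v) powr \<beta> * (u\<^sup>2 - 4 * v) powr \<gamma>)"

definition unit_square :: "(real \<times> real) set" where
  "unit_square = {-1..1} \<times> {-1..1}"

text \<open>
  Since \<open>0 powr a = 0\<close> for every \<open>a\<close>, this weight is 0 on the lines \<open>x = \<plusminus>y\<close>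
  and on the boundary of the square even where an exponent is 0 or negative. These are null sets.
\<close>

definition square_weight :: "real \<Rightarrow> real \<Rightarrow> real \<Rightarrow> real \<times> real \<Rightarrow> real" where
  "square_weight \<alpha> \<beta> \<gamma> = (\<lambda>(x, y).
     2 * norm_const \<alpha> \<beta> \<gamma> * 4 powr \<gamma> *
     \<bar>x - y\<bar> powr (2 * \<alpha> + 1) * \<bar>x + y\<bar> powr (2 * \<beta> + 1) *
     (1 - x\<^sup>2) powr \<gamma> * (1 - y\<^sup>2) powr \<gamma>)"

text \<open>The constant \<open>b\<close> with superscript \<open>(i, j)\<close>.\<close>

definition b_const :: "nat \<Rightarrow> nat \<Rightarrow> real \<Rightarrow> real \<Rightarrow> real \<Rightarrow> real" where
  "b_const i j \<alpha> \<beta> \<gamma> =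
     sqrt (norm_const (\<alpha> + real i) (\<beta> + real j) \<gamma> / norm_const \<alpha> \<beta> \<gamma>)"

text \<open>
  Here \<open>P \<alpha> \<beta> \<gamma> k n\<close> stands for the \<open>k\<close>-th basis element of degree \<open>n\<close> for the
  parameters \<open>\<alpha>, \<beta>, \<gamma>\<close>. The index \<open>m\<close> is half of the (floored) degree: the families below
  have degree \<open>2 m\<close> and \<open>2 m + 1\<close>. In \<open>Q2_even\<close>, \<open>m - 1\<close> is a natural-number subtraction;
  the family is indexed by \<open>k < m\<close>, hence is empty for \<open>m = 0\<close>.
\<close>

type_synonym basis_family = "real \<Rightarrow> real \<Rightarrow> real \<Rightarrow> nat \<Rightarrow> nat \<Rightarrow> real \<times> real \<Rightarrow> real"

definition Q1_even :: "basis_family \<Rightarrow> basis_family" where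
  "Q1_even P \<alpha> \<beta> \<gamma> k m = (\<lambda>(x, y). P \<alpha> \<beta> \<gamma> k m (2 * x * y, x\<^sup>2 + y\<^sup>2 - 1))"

definition Q2_even :: "basis_family \<Rightarrow> basis_family" where
  "Q2_even P \<alpha> \<beta> \<gamma> k m = (\<lambda>(x, y).
     b_const 1 1 \<alpha> \<beta> \<gamma> * (x\<^sup>2 - y\<^sup>2) *
     P (\<alpha> + 1) (\<beta> + 1) \<gamma> k (m - 1) (2 * x * y, x\<^sup>2 + y\<^sup>2 - 1))"

definition Q1_odd :: "basis_family \<Rightarrow> basis_family" where
  "Q1_odd P \<alpha> \<beta> \<gamma> k m = (\<lambda>(x, y).
     b_const 0 1 \<alpha> \<beta> \<gamma> * (x + y) *
     P \<alpha> (\<beta> + 1) \<gamma> k m (2 * x * y, x\<^sup>2 + y\<^sup>2 - 1))"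

definition Q2_odd :: "basis_family \<Rightarrow> basis_family" where
  "Q2_odd P \<alpha> \<beta> \<gamma> k m = (\<lambda>(x, y).
     b_const 1 0 \<alpha> \<beta> \<gamma> * (x - y) *
     P (\<alpha> + 1) \<beta> \<gamma> k m (2 * x * y, x\<^sup>2 + y\<^sup>2 - 1))"

end

theory Submission
  imports Defs
begin

text \<open>
  The map \<open>\<phi>(x, y) = (2 x y, x\<^sup>2 + y\<^sup>2 - 1)\<close> folds the square along its two diagonals onto the
  Koornwinder region. In the coordinates \<open>s = x + y\<close>, \<open>t = x - y\<close> it is
  \<open>(s, t) \<mapsto> (s\<^sup>2, t\<^sup>2)\<close> up to affine maps, so it transports the measure
  \<open>\<bar>x\<^sup>2 - y\<^sup>2\<bar> dx dy\<close> to Lebesgue measure (\<open>distr_pullback\<close>), and the bounding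
  polynomials \<open>1 \<plusminus> u + v\<close> and \<open>u\<^sup>2 - 4 v\<close> pull back to the squares \<open>(x \<plusminus> y)\<^sup>2\<close> and to
  \<open>4 (1 - x\<^sup>2) (1 - y\<^sup>2)\<close>. Hence integrating \<open>f \<circ> \<phi>\<close> against the weight of the square is the
  same as integrating \<open>f\<close> against the Koornwinder weight (\<open>set_integral_pullback\<close>).

  The functions \<open>f \<circ> \<phi>\<close> are those invariant under the reflections in the two diagonals.
  The factors \<open>x - y\<close>, \<open>x + y\<close> and \<open>x\<^sup>2 - y\<^sup>2\<close> supply the other three sign characters of these
  reflections. Products of two functions of different character are odd under one of the
  reflections and integrate to 0 (\<open>weighted_inner_twisted_distinct\<close>). For two functions of the
  same character the squared factor merges with the weight, which shifts \<open>\<alpha>\<close>, \<open>\<beta>\<close> or both by 1 and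
  changes the normalising constant by the ratio compensated by the \<open>b\<close> constants
  (\<open>weighted_inner_twisted_same\<close>). So the four families, in all degrees together, are
  orthonormal (\<open>square_poly_orthonormal\<close>).

  In degree \<open>N\<close> there are \<open>N + 1\<close> of them, and they are polynomials of degree at most \<open>N\<close>; a
  dimension count then shows that those of degree \<open>N\<close> form a basis of the space of polynomials
  of degree at most \<open>N\<close> orthogonal to all lower ones (\<open>orthonormal_basis_of_graded_family\<close>).
  The bilinearity that this count uses rests on the integrability of the weights, which the given
  basis in degree 0 already encodes (\<open>set_integrable_Koornwinder_weight\<close>).
\<close>

section \<open>The folding map as a change of variables\<close>

lemma nn_integral_Union_incseq:
  fixes g :: "real \<Rightarrow> ennreal"
  assumes [measurable]: "g \<in> borel_measurable borel" and A: "incseq A" "\<And>i. A i \<in> sets borel"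
  shows "(\<integral>\<^sup>+p. g p * indicator (\<Union>i. A i) p \<partial>lborel) = (SUP i. \<integral>\<^sup>+p. g p * indicator (A i) p \<partial>lborel)"
proof -
  have "(SUP i. emeasure (density lborel g) (A i)) = emeasure (density lborel g) (\<Union>i. A i)"
    using A by (intro SUP_emeasure_incseq) auto
  moreover have "(\<Union>i. A i) \<in> sets borel"
    using A by auto
  ultimately show ?thesis
    using A by (simp add: emeasure_density)
qed

lemma UN_atLeastAtMost_real:
  assumes "\<And>n. real n \<le> f n"
  shows "(\<Union>n. {0..f n}) = {0::real..}"
proof (intro equalityI subsetI)
  fix x :: real assume "x \<in> {0..}"
  moreover obtain n where "x \<le> real n"
    using real_arch_simple by blast
  ultimately show "x \<in> (\<Union>n. {0..f n})"
    using assms[of n] by (auto intro: order_trans)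
qed auto

text \<open>
  Monotone convergence along the intervals \<open>{0..n + 1}\<close>, whose images are \<open>{0..(n + 1)\<^sup>2}\<close>,
  reduces this to substitution on a bounded interval.
\<close>

lemma nn_integral_square_half:
  fixes g :: "real \<Rightarrow> ennreal"
  assumes [measurable]: "g \<in> borel_measurable borel"
  shows "(\<integral>\<^sup>+s. (g (s\<^sup>2) * ennreal (2 * s)) * indicator {0..} s \<partial>lborel) =
         (\<integral>\<^sup>+p. g p * indicator {0..} p \<partial>lborel)"
proof -
  have inc: "incseq (\<lambda>n. {0..real (Suc n)})" "incseq (\<lambda>n. {0..(real (Suc n))\<^sup>2})"
    by (auto simp: incseq_def intro!: power_mono elim!: order_trans)
  have "real n \<le> (real (Suc n))\<^sup>2" for n
    by (simp add: power2_eq_square algebra_simps)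
  then have U: "(\<Union>n. {0..(real (Suc n))\<^sup>2}) = {0..}" "(\<Union>n. {0..real (Suc n)}) = {0..}"
    by (intro UN_atLeastAtMost_real; simp)+
  have "(\<integral>\<^sup>+s. (g (s\<^sup>2) * ennreal (2 * s)) * indicator {0..} s \<partial>lborel) =
     (SUP n. \<integral>\<^sup>+s. (g (s\<^sup>2) * ennreal (2 * s)) * indicator {0..real (Suc n)} s \<partial>lborel)"
    unfolding U(2)[symmetric] by (intro nn_integral_Union_incseq inc(1)) auto
  also have "\<dots> = (SUP n. \<integral>\<^sup>+p. g p * indicator {0..(real (Suc n))\<^sup>2} p \<partial>lborel)"
  proof (intro SUP_cong refl)
    fix n
    have "(power2 has_real_derivative 2 * x) (at x)" for x :: real
      by (auto intro!: derivative_eq_intros)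
    then show "(\<integral>\<^sup>+s. (g (s\<^sup>2) * ennreal (2 * s)) * indicator {0..real (Suc n)} s \<partial>lborel) =
          (\<integral>\<^sup>+p. g p * indicator {0..(real (Suc n))\<^sup>2} p \<partial>lborel)"
      using nn_integral_substitution_aux[of g 0 "real (Suc n)" "\<lambda>s. s\<^sup>2" "\<lambda>s. 2 * s"]
      by (auto simp del: of_nat_Suc intro!: derivative_eq_intros continuous_intros)
  qed
  also have "\<dots> = (\<integral>\<^sup>+p. g p * indicator {0..} p \<partial>lborel)"
    unfolding U(1)[symmetric] by (intro nn_integral_Union_incseq[symmetric] inc(2)) auto
  finally show ?thesis .
qed

text \<open>
  The map \<open>s \<mapsto> s\<^sup>2\<close> is two-to-one with derivative \<open>2 s\<close>: the two sheets cancel the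
  factor 2, so that the density \<open>\<bar>s\<bar>\<close> is carried to Lebesgue measure on the positive half-line.
\<close>

lemma nn_integral_square:
  fixes g :: "real \<Rightarrow> ennreal"
  assumes [measurable]: "g \<in> borel_measurable borel"
  shows "(\<integral>\<^sup>+s. ennreal \<bar>s\<bar> * g (s\<^sup>2) \<partial>lborel) = (\<integral>\<^sup>+p. indicator {0<..} p * g p \<partial>lborel)"
proof -
  define F where "F s = (g (s\<^sup>2) * ennreal (2 * s)) * indicator {0..} s" for s
  have [measurable]: "F \<in> borel_measurable borel"
    unfolding F_def by measurable
  have split: "2 * (ennreal \<bar>s\<bar> * g (s\<^sup>2)) = F s + F (0 + (-1) * s)" for s
  proof -
    have "2 * (ennreal \<bar>s\<bar> * g (s\<^sup>2)) = g (s\<^sup>2) * ennreal (2 * \<bar>s\<bar>)"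
      by (simp add: ennreal_mult' mult_ac)
    then show ?thesis
      by (cases s "0::real" rule: linorder_cases) (auto simp: F_def)
  qed
  have "2 * (\<integral>\<^sup>+s. ennreal \<bar>s\<bar> * g (s\<^sup>2) \<partial>lborel) = (\<integral>\<^sup>+s. F s + F (0 + (-1) * s) \<partial>lborel)"
    unfolding split[symmetric] by (rule nn_integral_cmult[symmetric]) measurable
  also have "\<dots> = (\<integral>\<^sup>+s. F s \<partial>lborel) + (\<integral>\<^sup>+s. F (0 + (-1) * s) \<partial>lborel)"
    by (rule nn_integral_add) auto
  also have "\<dots> = 2 * (\<integral>\<^sup>+s. F s \<partial>lborel)"
    using nn_integral_real_affine[of F "-1" 0] by (simp add: mult_2)
  also have "(\<integral>\<^sup>+s. F s \<partial>lborel) = (\<integral>\<^sup>+p. g p * indicator {0..} p \<partial>lborel)"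
    unfolding F_def by (rule nn_integral_square_half) fact
  also have "\<dots> = (\<integral>\<^sup>+p. indicator {0<..} p * g p \<partial>lborel)"
    using AE_lborel_singleton[of "0::real"]
    by (intro nn_integral_cong_AE) (auto elim!: eventually_mono simp: indicator_def)
  finally show ?thesis
    by (simp add: ennreal_mult_cancel_left)
qed

lemma borel_measurable_fst_snd [measurable]:
  "(fst :: real \<times> real \<Rightarrow> real) \<in> borel_measurable borel"
  "(snd :: real \<times> real \<Rightarrow> real) \<in> borel_measurable borel"
  unfolding borel_prod[symmetric] by measurable

lemma nn_integral_lborel_pair:
  fixes F :: "real \<times> real \<Rightarrow> ennreal"
  assumes [measurable]: "F \<in> borel_measurable borel"
  shows "(\<integral>\<^sup>+z. F z \<partial>lborel) = (\<integral>\<^sup>+x. \<integral>\<^sup>+y. F (x, y) \<partial>lborel \<partial>lborel)"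
    and "(\<integral>\<^sup>+z. F z \<partial>lborel) = (\<integral>\<^sup>+y. \<integral>\<^sup>+x. F (x, y) \<partial>lborel \<partial>lborel)"
proof -
  have F: "F \<in> borel_measurable (lborel \<Otimes>\<^sub>M lborel)"
    unfolding lborel_prod by simp
  show "(\<integral>\<^sup>+z. F z \<partial>lborel) = (\<integral>\<^sup>+x. \<integral>\<^sup>+y. F (x, y) \<partial>lborel \<partial>lborel)"
    using lborel.nn_integral_fst[OF F] unfolding lborel_prod by simp
  show "(\<integral>\<^sup>+z. F z \<partial>lborel) = (\<integral>\<^sup>+y. \<integral>\<^sup>+x. F (x, y) \<partial>lborel \<partial>lborel)"
    using lborel_pair.nn_integral_snd[OF F] unfolding lborel_prod by simp
qed

text \<open>
  The linear map \<open>(x, y) \<mapsto> (x + y, x - y)\<close> has determinant of modulus 2. By Tonelli it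
  splits into two one-dimensional affine substitutions: first \<open>s = x + y\<close> with \<open>y\<close> fixed, then
  \<open>t = s - 2 y\<close> with \<open>s\<close> fixed.
\<close>

lemma nn_integral_sum_diff:
  fixes F :: "real \<times> real \<Rightarrow> ennreal"
  assumes [measurable]: "F \<in> borel_measurable borel"
  shows "2 * (\<integral>\<^sup>+(x, y). F (x + y, x - y) \<partial>lborel) = (\<integral>\<^sup>+z. F z \<partial>lborel)"
proof -
  have [measurable]: "(\<lambda>(x, y). F (x + y, x - y)) \<in> borel_measurable borel"
    "(\<lambda>(s, y). F (s, s - 2 * y)) \<in> borel_measurable borel"
    unfolding borel_prod[symmetric] by (simp_all add: split_beta')
  have "(\<integral>\<^sup>+(x, y). F (x + y, x - y) \<partial>lborel) = (\<integral>\<^sup>+y. \<integral>\<^sup>+x. F (x + y, x - y) \<partial>lborel \<partial>lborel)"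
    by (subst nn_integral_lborel_pair(2)) auto
  also have "\<dots> = (\<integral>\<^sup>+y. \<integral>\<^sup>+s. F (s, s - 2 * y) \<partial>lborel \<partial>lborel)"
  proof (rule nn_integral_cong)
    fix y :: real
    show "(\<integral>\<^sup>+x. F (x + y, x - y) \<partial>lborel) = (\<integral>\<^sup>+s. F (s, s - 2 * y) \<partial>lborel)"
      by (subst nn_integral_real_affine[of "\<lambda>s. F (s, s - 2 * y)" 1 y]) (auto simp: algebra_simps)
  qed
  also have "\<dots> = (\<integral>\<^sup>+(s, y). F (s, s - 2 * y) \<partial>lborel)"
    by (subst nn_integral_lborel_pair(2)) auto
  also have "\<dots> = (\<integral>\<^sup>+s. \<integral>\<^sup>+y. F (s, s - 2 * y) \<partial>lborel \<partial>lborel)"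
    by (subst nn_integral_lborel_pair(1)) auto
  also have "2 * \<dots> = (\<integral>\<^sup>+s. 2 * (\<integral>\<^sup>+y. F (s, s - 2 * y) \<partial>lborel) \<partial>lborel)"
    by (subst nn_integral_cmult[symmetric]) simp_all
  also have "\<dots> = (\<integral>\<^sup>+s. \<integral>\<^sup>+t. F (s, t) \<partial>lborel \<partial>lborel)"
  proof (rule nn_integral_cong)
    fix s :: real
    show "2 * (\<integral>\<^sup>+y. F (s, s - 2 * y) \<partial>lborel) = (\<integral>\<^sup>+t. F (s, t) \<partial>lborel)"
      by (subst nn_integral_real_affine[of "\<lambda>t. F (s, t)" "-2" s]) (auto simp: algebra_simps)
  qed
  also have "\<dots> = (\<integral>\<^sup>+z. F z \<partial>lborel)"
    by (subst nn_integral_lborel_pair(1)) auto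
  finally show ?thesis .
qed

definition folding_map :: "real \<times> real \<Rightarrow> real \<times> real" where
  "folding_map = (\<lambda>(x, y). (2 * x * y, x\<^sup>2 + y\<^sup>2 - 1))"

text \<open>
  The image of the plane minus the diagonals \<open>x = \<plusminus>y\<close> under the folding map.
\<close>

definition tangent_cone :: "(real \<times> real) set" where
  "tangent_cone = {(u, v). 1 + u + v > 0 \<and> 1 - u + v > 0}"

lemma measurable_folding_map [measurable]: "folding_map \<in> borel_measurable borel"
  unfolding folding_map_def borel_prod[symmetric] by measurable

lemma sets_tangent_cone [measurable]: "tangent_cone \<in> sets borel"
proof -
  have "tangent_cone = {z \<in> space borel. 1 + fst z + snd z > 0 \<and> 1 - fst z + snd z > 0}"
    by (auto simp: tangent_cone_def)
  moreover have "{z \<in> space borel. 1 + fst z + snd z > 0 \<and> 1 - fst z + snd z > (0::real)} \<in> sets borel"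
    by measurable
  ultimately show ?thesis
    by (simp only:)
qed

text \<open>
  With \<open>s = x + y\<close> and \<open>t = x - y\<close> the folding map becomes \<open>(s, t) \<mapsto> (s\<^sup>2, t\<^sup>2)\<close> followed by an
  affine map, and \<open>\<bar>x\<^sup>2 - y\<^sup>2\<bar> = \<bar>s\<bar> \<bar>t\<bar>\<close>. So the substitution is a product of two
  one-dimensional squarings between two affine maps whose determinants cancel. Squaring over
  the whole line accounts for both of its sheets at once, so the four sheets of the folding map
  never have to be separated.
\<close>

lemma nn_integral_pullback:
  fixes h :: "real \<times> real \<Rightarrow> ennreal"
  assumes [measurable]: "h \<in> borel_measurable borel"
  shows "(\<integral>\<^sup>+z. ennreal \<bar>(fst z)\<^sup>2 - (snd z)\<^sup>2\<bar> * h (folding_map z) \<partial>lborel) =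
         (\<integral>\<^sup>+z. indicator tangent_cone z * h z \<partial>lborel)"
proof -
  (* G is h in the coordinates (p, q) = (1 + u + v, 1 - u + v), where the cone is a quadrant. *)
  define G where "G = (\<lambda>(p, q). h ((p - q) / 2, (p + q) / 2 - 1))"
  have [measurable]: "G \<in> borel_measurable borel"
    unfolding G_def borel_prod[symmetric] by (simp add: split_beta')
  define F where "F = (\<lambda>z::real \<times> real. ennreal \<bar>fst z\<bar> * (ennreal \<bar>snd z\<bar> * G ((fst z)\<^sup>2, (snd z)\<^sup>2)))"
  have [measurable]: "F \<in> borel_measurable borel"
    unfolding F_def by measurable
  define H where "H = (\<lambda>z::real \<times> real. indicator {0<..} (fst z) * (indicator {0<..} (snd z) * G z))"
  have [measurable]: "H \<in> borel_measurable borel"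
    unfolding H_def by measurable
  have F: "F (x + y, x - y) = ennreal \<bar>x\<^sup>2 - y\<^sup>2\<bar> * h (folding_map (x, y))" for x y
  proof -
    have "\<bar>x\<^sup>2 - y\<^sup>2\<bar> = \<bar>x + y\<bar> * \<bar>x - y\<bar>"
      by (simp add: abs_mult[symmetric] power2_eq_square algebra_simps)
    moreover have "((x + y)\<^sup>2 - (x - y)\<^sup>2) / 2 = 2 * x * y" "((x + y)\<^sup>2 + (x - y)\<^sup>2) / 2 = x\<^sup>2 + y\<^sup>2"
      by (simp_all add: power2_eq_square field_simps)
    then have "G ((x + y)\<^sup>2, (x - y)\<^sup>2) = h (folding_map (x, y))"
      by (simp only: G_def folding_map_def prod.case)
    ultimately show ?thesis
      by (simp add: F_def ennreal_mult mult_ac)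
  qed
  have "2 * (\<integral>\<^sup>+z. ennreal \<bar>(fst z)\<^sup>2 - (snd z)\<^sup>2\<bar> * h (folding_map z) \<partial>lborel) = (\<integral>\<^sup>+z. F z \<partial>lborel)"
    by (subst nn_integral_sum_diff[symmetric]) (auto simp: F split_beta')
  also have "\<dots> = (\<integral>\<^sup>+s. \<integral>\<^sup>+t. F (s, t) \<partial>lborel \<partial>lborel)"
    by (rule nn_integral_lborel_pair) simp
  also have "\<dots> = (\<integral>\<^sup>+s. ennreal \<bar>s\<bar> * (\<integral>\<^sup>+t. ennreal \<bar>t\<bar> * G (s\<^sup>2, t\<^sup>2) \<partial>lborel) \<partial>lborel)"
    by (simp add: F_def nn_integral_cmult)
  also have "\<dots> = (\<integral>\<^sup>+s. ennreal \<bar>s\<bar> * (\<integral>\<^sup>+q. indicator {0<..} q * G (s\<^sup>2, q) \<partial>lborel) \<partial>lborel)"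
    by (subst nn_integral_square) auto
  also have "\<dots> = (\<integral>\<^sup>+p. indicator {0<..} p * (\<integral>\<^sup>+q. indicator {0<..} q * G (p, q) \<partial>lborel) \<partial>lborel)"
    by (rule nn_integral_square[where g = "\<lambda>p. \<integral>\<^sup>+q. indicator {0<..} q * G (p, q) \<partial>lborel"]) measurable
  also have "\<dots> = (\<integral>\<^sup>+p. \<integral>\<^sup>+q. H (p, q) \<partial>lborel \<partial>lborel)"
    by (simp add: H_def nn_integral_cmult)
  also have "\<dots> = (\<integral>\<^sup>+z. H z \<partial>lborel)"
    by (rule nn_integral_lborel_pair[symmetric]) simp
  also have "\<dots> = 2 * (\<integral>\<^sup>+(v, u). H (v + u, v - u) \<partial>lborel)"
    by (rule nn_integral_sum_diff[symmetric]) simp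
  also have "(\<integral>\<^sup>+(v, u). H (v + u, v - u) \<partial>lborel) = (\<integral>\<^sup>+u. \<integral>\<^sup>+v. H (v + u, v - u) \<partial>lborel \<partial>lborel)"
    by (subst nn_integral_lborel_pair(2)) auto
  also have "\<dots> = (\<integral>\<^sup>+u. \<integral>\<^sup>+v. indicator tangent_cone (u, v) * h (u, v) \<partial>lborel \<partial>lborel)"
  proof (rule nn_integral_cong)
    fix u :: real
    have "H (1 + v + u, 1 + v - u) = indicator tangent_cone (u, v) * h (u, v)" for v
    proof -
      have "((1 + v + u) - (1 + v - u)) / 2 = u" "((1 + v + u) + (1 + v - u)) / 2 - 1 = v"
        by (simp_all add: field_simps)
      then have "G (1 + v + u, 1 + v - u) = h (u, v)"
        by (simp only: G_def prod.case)
      then show ?thesis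
        by (auto simp: H_def tangent_cone_def indicator_def algebra_simps)
    qed
    then show "(\<integral>\<^sup>+v. H (v + u, v - u) \<partial>lborel) =
        (\<integral>\<^sup>+v. indicator tangent_cone (u, v) * h (u, v) \<partial>lborel)"
      (* The summand -1 in the second component of the folding map is a translation of v. *)
      by (subst nn_integral_real_affine[of _ 1 1]) auto
  qed
  also have "\<dots> = (\<integral>\<^sup>+z. indicator tangent_cone z * h z \<partial>lborel)"
    by (rule nn_integral_lborel_pair[symmetric]) measurable
  finally show ?thesis
    by (simp add: ennreal_mult_cancel_left)
qed

text \<open>
  As an identity of measures the substitution applies to signed integrands, and transports
  integrability, with no case distinction.
\<close>

lemma distr_pullback:
  "distr (density lborel (\<lambda>z. ennreal \<bar>(fst z)\<^sup>2 - (snd z)\<^sup>2\<bar>)) borel folding_map =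
   density lborel (\<lambda>z. ennreal (indicator tangent_cone z))"
proof (rule measure_eqI)
  fix A assume "A \<in> sets (distr (density lborel (\<lambda>z. ennreal \<bar>(fst z)\<^sup>2 - (snd z)\<^sup>2\<bar>)) borel folding_map)"
  then have A[measurable]: "A \<in> sets borel"
    by simp
  have "folding_map -` A \<in> sets borel"
    using measurable_sets[OF measurable_folding_map A] by simp
  moreover have "indicator (folding_map -` A) z = (indicator A (folding_map z) :: ennreal)" for z
    by (simp add: indicator_def)
  ultimately show "emeasure (distr (density lborel (\<lambda>z. ennreal \<bar>(fst z)\<^sup>2 - (snd z)\<^sup>2\<bar>)) borel folding_map) A =
        emeasure (density lborel (\<lambda>z. ennreal (indicator tangent_cone z))) A"
    using nn_integral_pullback[of "indicator A"]
    by (simp add: emeasure_distr emeasure_density ennreal_indicator)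
qed simp

lemma
  fixes h :: "real \<times> real \<Rightarrow> real"
  assumes [measurable]: "h \<in> borel_measurable borel"
  shows integral_pullback:
      "(\<integral>z. \<bar>(fst z)\<^sup>2 - (snd z)\<^sup>2\<bar> * h (folding_map z) \<partial>lborel) =
       (\<integral>z. indicator tangent_cone z * h z \<partial>lborel)" (is ?A)
    and integrable_pullback:
      "integrable lborel (\<lambda>z. \<bar>(fst z)\<^sup>2 - (snd z)\<^sup>2\<bar> * h (folding_map z)) \<longleftrightarrow>
       integrable lborel (\<lambda>z. indicator tangent_cone z * h z)" (is ?B)
proof -
  let ?D = "density lborel (\<lambda>z. ennreal \<bar>(fst z)\<^sup>2 - (snd z)\<^sup>2\<bar>) :: (real \<times> real) measure"
  have "(\<integral>z. \<bar>(fst z)\<^sup>2 - (snd z)\<^sup>2\<bar> * h (folding_map z) \<partial>lborel) = (\<integral>z. h (folding_map z) \<partial>?D)"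
    by (subst integral_density) auto
  also have "\<dots> = (\<integral>z. h z \<partial>distr ?D borel folding_map)"
    by (subst integral_distr) auto
  also have "\<dots> = (\<integral>z. indicator tangent_cone z * h z \<partial>lborel)"
    unfolding distr_pullback by (subst integral_density) auto
  finally show ?A .
  have "integrable lborel (\<lambda>z. \<bar>(fst z)\<^sup>2 - (snd z)\<^sup>2\<bar> * h (folding_map z)) \<longleftrightarrow> integrable ?D (\<lambda>z. h (folding_map z))"
    by (subst integrable_density) auto
  also have "\<dots> \<longleftrightarrow> integrable (distr ?D borel folding_map) h"
    by (subst integrable_distr_eq) auto
  also have "\<dots> \<longleftrightarrow> integrable lborel (\<lambda>z. indicator tangent_cone z * h z)"
    unfolding distr_pullback by (subst integrable_density) auto
  finally show ?B .
qed

section \<open>Comparing the two weights\<close>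

lemma measurable_Koornwinder_weight [measurable]:
  "Koornwinder_weight \<alpha> \<beta> \<gamma> \<in> borel_measurable borel"
  unfolding Koornwinder_weight_def split_beta' by measurable

lemma measurable_square_weight [measurable]:
  "square_weight \<alpha> \<beta> \<gamma> \<in> borel_measurable borel"
  unfolding square_weight_def split_beta' by measurable

lemma sets_Koornwinder_region [measurable]: "Koornwinder_region \<in> sets borel"
proof -
  have "Koornwinder_region = {z \<in> space borel. 1 + fst z + snd z > 0 \<and> 1 - fst z + snd z > 0 \<and>
      (fst z)\<^sup>2 > 4 * snd z \<and> \<bar>fst z\<bar> < 2}"
    by (auto simp: Koornwinder_region_def)
  moreover have "{z \<in> space borel. 1 + fst z + snd z > 0 \<and> 1 - fst z + snd z > 0 \<and>
      (fst z)\<^sup>2 > 4 * snd z \<and> \<bar>fst z\<bar> < (2::real)} \<in> sets borel"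
    by measurable
  ultimately show ?thesis
    by (simp only:)
qed

lemma sets_unit_square [measurable]: "unit_square \<in> sets borel"
  unfolding unit_square_def by (intro borel_closed closed_Times) auto

lemma power2_powr_eq: "(t\<^sup>2) powr a = \<bar>t\<bar> powr (2 * a)" for t a :: real
proof -
  have "t\<^sup>2 = \<bar>t\<bar> powr 2"
    by simp
  then show ?thesis
    by (simp only: powr_powr)
qed

text \<open>
  At \<open>(u, v) = (2 x y, x\<^sup>2 + y\<^sup>2 - 1)\<close> the three polynomials bounding the region factor as
  \<open>1 + u + v = (x + y)\<^sup>2\<close>, \<open>1 - u + v = (x - y)\<^sup>2\<close> and
  \<open>u\<^sup>2 - 4 v = 4 (1 - x\<^sup>2) (1 - y\<^sup>2)\<close>. The bound \<open>\<bar>u\<bar> < 2\<close>, that is \<open>\<bar>x y\<bar> < 1\<close>, excludes the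
  case in which both factors of the last product are negative.
\<close>

lemma folding_map_in_region_iff:
  assumes "x\<^sup>2 \<noteq> y\<^sup>2"
  shows "folding_map (x, y) \<in> Koornwinder_region \<longleftrightarrow> \<bar>x\<bar> < 1 \<and> \<bar>y\<bar> < 1"
proof -
  have ne: "x + y \<noteq> 0" "x - y \<noteq> 0"
    using assms by (auto simp: power2_eq_iff add_eq_0_iff2)
  have sq: "1 + 2 * x * y + (x\<^sup>2 + y\<^sup>2 - 1) = (x + y)\<^sup>2" "1 - 2 * x * y + (x\<^sup>2 + y\<^sup>2 - 1) = (x - y)\<^sup>2"
    by (simp_all add: power2_eq_square algebra_simps)
  have disc: "4 * (x\<^sup>2 + y\<^sup>2 - 1) < (2 * x * y)\<^sup>2 \<longleftrightarrow> 0 < (1 - x\<^sup>2) * (1 - y\<^sup>2)"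
  proof -
    have "(2 * x * y)\<^sup>2 - 4 * (x\<^sup>2 + y\<^sup>2 - 1) = 4 * ((1 - x\<^sup>2) * (1 - y\<^sup>2))"
      by (simp add: power2_eq_square algebra_simps)
    then show ?thesis
      by linarith
  qed
  have abs: "\<bar>2 * x * y\<bar> < 2 \<longleftrightarrow> x\<^sup>2 * y\<^sup>2 < 1"
    by (simp add: abs_mult power_mult_distrib[symmetric] abs_square_less_1)
  have sq1: "\<bar>t\<bar> < 1 \<longleftrightarrow> t\<^sup>2 < 1" for t :: real
    by (simp add: abs_square_less_1)
  have "0 < (1 - x\<^sup>2) * (1 - y\<^sup>2) \<and> x\<^sup>2 * y\<^sup>2 < 1 \<longleftrightarrow> x\<^sup>2 < 1 \<and> y\<^sup>2 < 1"
  proof safe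
    assume *: "0 < (1 - x\<^sup>2) * (1 - y\<^sup>2)" "x\<^sup>2 * y\<^sup>2 < 1"
    have "\<not> (x\<^sup>2 > 1 \<and> y\<^sup>2 > 1)"
      using *(2) less_1_mult[of "x\<^sup>2" "y\<^sup>2"] by auto
    then show "x\<^sup>2 < 1" "y\<^sup>2 < 1"
      using *(1) by (auto simp: zero_less_mult_iff)
  next
    assume *: "x\<^sup>2 < 1" "y\<^sup>2 < 1"
    then show "0 < (1 - x\<^sup>2) * (1 - y\<^sup>2)"
      by simp
    show "x\<^sup>2 * y\<^sup>2 < 1"
      using mult_strict_mono[OF *] by simp
  qed
  then show ?thesis
    using ne
    by (simp only: folding_map_def Koornwinder_region_def mem_Collect_eq prod.case sq disc abs sq1
          zero_less_power2) blast
qed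

text \<open>
  By the same factorisations, the weight on the square is the weight on the region pulled back,
  times the density \<open>\<bar>x\<^sup>2 - y\<^sup>2\<bar>\<close> of the substitution. The identity holds at every point, not
  just almost everywhere: on the diagonals and on the boundary of the square both sides vanish,
  the right-hand side because \<open>0 powr a = 0\<close>.
\<close>

lemma square_weight_eq_pullback:
  "\<bar>(fst z)\<^sup>2 - (snd z)\<^sup>2\<bar> *
     (indicator Koornwinder_region (folding_map z) * Koornwinder_weight \<alpha> \<beta> \<gamma> (folding_map z)) =
   indicator unit_square z * square_weight \<alpha> \<beta> \<gamma> z"
proof (cases z)
  case (Pair x y)
  consider "x\<^sup>2 = y\<^sup>2" | "x\<^sup>2 \<noteq> y\<^sup>2" "\<not> (\<bar>x\<bar> < 1 \<and> \<bar>y\<bar> < 1)" | "x\<^sup>2 \<noteq> y\<^sup>2" "\<bar>x\<bar> < 1" "\<bar>y\<bar> < 1"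
    by blast
  then show ?thesis
  proof cases
    case 1
    then have "x = y \<or> x = - y"
      by (simp add: power2_eq_iff)
    with 1 show ?thesis
      by (auto simp: Pair square_weight_def)
  next
    case 2
    (* A point of the square outside its interior lies on an edge, where the weight is 0. *)
    have "\<bar>x\<bar> = 1 \<or> \<bar>y\<bar> = 1" if "z \<in> unit_square"
      using that 2 by (auto simp: Pair unit_square_def)
    then have "square_weight \<alpha> \<beta> \<gamma> z = 0" if "z \<in> unit_square"
      using that by (fastforce simp: Pair square_weight_def power2_eq_1_iff abs_eq_iff')
    with 2 show ?thesis
      by (simp add: Pair folding_map_in_region_iff indicator_def)
  next
    case 3
    have J: "\<bar>x\<^sup>2 - y\<^sup>2\<bar> = \<bar>x - y\<bar> * \<bar>x + y\<bar>"
      by (simp add: abs_mult[symmetric] power2_eq_square algebra_simps)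
    have sq: "1 + 2 * x * y + (x\<^sup>2 + y\<^sup>2 - 1) = (x + y)\<^sup>2" "1 - 2 * x * y + (x\<^sup>2 + y\<^sup>2 - 1) = (x - y)\<^sup>2"
      "(2 * x * y)\<^sup>2 - 4 * (x\<^sup>2 + y\<^sup>2 - 1) = 4 * ((1 - x\<^sup>2) * (1 - y\<^sup>2))"
      by (simp_all add: power2_eq_square algebra_simps)
    have "x\<^sup>2 < 1" "y\<^sup>2 < 1"
      using 3 by (simp_all add: abs_square_less_1)
    then have "(4 * ((1 - x\<^sup>2) * (1 - y\<^sup>2))) powr \<gamma> = 4 powr \<gamma> * ((1 - x\<^sup>2) powr \<gamma> * (1 - y\<^sup>2) powr \<gamma>)"
      by (simp add: powr_mult)
    then have W: "Koornwinder_weight \<alpha> \<beta> \<gamma> (folding_map z) = 2 * norm_const \<alpha> \<beta> \<gamma> *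
        \<bar>x - y\<bar> powr (2 * \<alpha>) * \<bar>x + y\<bar> powr (2 * \<beta>) * (4 powr \<gamma> * ((1 - x\<^sup>2) powr \<gamma> * (1 - y\<^sup>2) powr \<gamma>))"
      by (simp only: Pair Koornwinder_weight_def folding_map_def prod.case sq power2_powr_eq)
    have "folding_map z \<in> Koornwinder_region" "z \<in> unit_square"
      using 3 by (auto simp: Pair folding_map_in_region_iff unit_square_def)
    then have ind: "indicator Koornwinder_region (folding_map z) = (1::real)" "indicator unit_square z = (1::real)"
      by simp_all
    have S: "square_weight \<alpha> \<beta> \<gamma> z = 2 * norm_const \<alpha> \<beta> \<gamma> * 4 powr \<gamma> * (\<bar>x - y\<bar> powr (2 * \<alpha>) * \<bar>x - y\<bar>) *
        (\<bar>x + y\<bar> powr (2 * \<beta>) * \<bar>x + y\<bar>) * (1 - x\<^sup>2) powr \<gamma> * (1 - y\<^sup>2) powr \<gamma>"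
      by (simp only: Pair square_weight_def prod.case powr_add powr_one abs_ge_zero)
    have "\<bar>(fst z)\<^sup>2 - (snd z)\<^sup>2\<bar> = \<bar>x - y\<bar> * \<bar>x + y\<bar>"
      using J by (simp add: Pair)
    then show ?thesis
      by (simp only: W S ind mult_1 mult_ac)
  qed
qed

lemma Koornwinder_region_subset_cone: "Koornwinder_region \<subseteq> tangent_cone"
  by (auto simp: Koornwinder_region_def tangent_cone_def)

text \<open>
  The normalising constants of the two weights match, so that integrals over the square and over
  the region agree without any factor.
\<close>

lemma
  fixes f :: "real \<times> real \<Rightarrow> real"
  assumes [measurable]: "f \<in> borel_measurable borel"
  shows set_integral_pullback:
      "set_lebesgue_integral lborel unit_square (\<lambda>z. f (folding_map z) * square_weight \<alpha> \<beta> \<gamma> z) =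
       set_lebesgue_integral lborel Koornwinder_region (\<lambda>z. f z * Koornwinder_weight \<alpha> \<beta> \<gamma> z)"
    and set_integrable_pullback:
      "set_integrable lborel unit_square (\<lambda>z. f (folding_map z) * square_weight \<alpha> \<beta> \<gamma> z) \<longleftrightarrow>
       set_integrable lborel Koornwinder_region (\<lambda>z. f z * Koornwinder_weight \<alpha> \<beta> \<gamma> z)"
proof -
  define h where "h z = indicator Koornwinder_region z * (f z * Koornwinder_weight \<alpha> \<beta> \<gamma> z)" for z
  have [measurable]: "h \<in> borel_measurable borel"
    unfolding h_def by measurable
  have cone: "indicator tangent_cone z * h z = h z" for z
    using Koornwinder_region_subset_cone by (auto simp: h_def indicator_def)
  have sq: "indicator unit_square z * (f (folding_map z) * square_weight \<alpha> \<beta> \<gamma> z) =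
      \<bar>(fst z)\<^sup>2 - (snd z)\<^sup>2\<bar> * h (folding_map z)" for z
  proof -
    have "indicator unit_square z * (f (folding_map z) * square_weight \<alpha> \<beta> \<gamma> z) =
        f (folding_map z) * (indicator unit_square z * square_weight \<alpha> \<beta> \<gamma> z)"
      by (simp only: mult_ac)
    also have "\<dots> = \<bar>(fst z)\<^sup>2 - (snd z)\<^sup>2\<bar> * h (folding_map z)"
      by (simp only: square_weight_eq_pullback[symmetric] h_def mult_ac)
    finally show ?thesis .
  qed
  show "set_lebesgue_integral lborel unit_square (\<lambda>z. f (folding_map z) * square_weight \<alpha> \<beta> \<gamma> z) =
      set_lebesgue_integral lborel Koornwinder_region (\<lambda>z. f z * Koornwinder_weight \<alpha> \<beta> \<gamma> z)"
    unfolding set_lebesgue_integral_def real_scaleR_def sq h_def[symmetric]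
    using integral_pullback[of h] by (simp add: cone)
  show "set_integrable lborel unit_square (\<lambda>z. f (folding_map z) * square_weight \<alpha> \<beta> \<gamma> z) \<longleftrightarrow>
      set_integrable lborel Koornwinder_region (\<lambda>z. f z * Koornwinder_weight \<alpha> \<beta> \<gamma> z)"
    unfolding set_integrable_def real_scaleR_def sq h_def[symmetric]
    using integrable_pullback[of h] by (simp add: cone)
qed

section \<open>The four symmetry types of polynomials on the square\<close>

lemma integral_eq_0_of_odd:
  fixes F :: "real \<times> real \<Rightarrow> real"
  assumes [measurable]: "F \<in> borel_measurable borel" "\<sigma> \<in> borel_measurable borel"
    and \<sigma>: "distr lborel borel \<sigma> = lborel" and odd: "\<And>z. F (\<sigma> z) = - F z"
  shows "(\<integral>z. F z \<partial>lborel) = 0"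
proof -
  have "(\<integral>z. F z \<partial>lborel) = (\<integral>z. F z \<partial>distr lborel borel \<sigma>)"
    by (simp add: \<sigma>)
  also have "\<dots> = (\<integral>z. F (\<sigma> z) \<partial>lborel)"
    by (rule integral_distr) auto
  finally show ?thesis
    by (simp add: odd)
qed

lemma lborel_distr_swap: "distr lborel borel prod.swap = (lborel :: (real \<times> real) measure)"
proof -
  have "lborel = distr (lborel \<Otimes>\<^sub>M lborel) (lborel \<Otimes>\<^sub>M lborel) (\<lambda>(x, y). (y, x) :: real \<times> real)"
    using lborel_pair.distr_pair_swap[where ?'a = real and ?'b = real] by (simp add: lborel_prod)
  then show ?thesis
    unfolding lborel_prod by (auto simp: prod.swap_def split_beta' cong: distr_cong)
qed

lemma lborel_distr_neg: "distr lborel borel uminus = (lborel :: (real \<times> real) measure)"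
  by (subst (2) lborel_affine[of "-1" 0]) (simp_all add: density_1 one_ennreal_def[symmetric])

lemma lborel_distr_swap_neg: "distr lborel borel (\<lambda>z. - prod.swap z) = (lborel :: (real \<times> real) measure)"
proof -
  have [measurable]: "prod.swap \<in> borel_measurable (borel :: (real \<times> real) measure)"
    unfolding prod.swap_def by measurable
  have "distr (distr lborel borel prod.swap) borel uminus = distr lborel borel (uminus \<circ> (prod.swap :: real \<times> real \<Rightarrow> _))"
    by (rule distr_distr) auto
  then show ?thesis
    by (simp add: lborel_distr_swap lborel_distr_neg comp_def)
qed

text \<open>
  For \<open>i, j \<le> 1\<close> these functions lie in the four isotypic components under the group generated by
  the reflections in the two diagonals: the reflection \<open>(x, y) \<mapsto> (y, x)\<close> acts by the sign
  \<open>(-1)^i\<close>, and \<open>(x, y) \<mapsto> (-y, -x)\<close> by \<open>(-1)^j\<close>.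
\<close>

definition twisted_pullback :: "nat \<Rightarrow> nat \<Rightarrow> (real \<times> real \<Rightarrow> real) \<Rightarrow> real \<times> real \<Rightarrow> real" where
  "twisted_pullback i j f = (\<lambda>(x, y). (x - y) ^ i * (x + y) ^ j * f (folding_map (x, y)))"

lemma measurable_twisted_pullback [measurable]:
  assumes [measurable]: "f \<in> borel_measurable borel"
  shows "twisted_pullback i j f \<in> borel_measurable borel"
  unfolding twisted_pullback_def split_beta' by measurable

lemma norm_const_pos:
  assumes "admissible \<alpha> \<beta> \<gamma>"
  shows "norm_const \<alpha> \<beta> \<gamma> > 0"
proof -
  have "\<alpha> + 1 > 0" "\<beta> + 1 > 0" "\<gamma> + 1 > 0" "\<alpha> + \<gamma> + 3/2 > 0" "\<beta> + \<gamma> + 3/2 > 0"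
    "\<alpha> + \<beta> + \<gamma> + 5/2 > 0" "\<alpha> + \<beta> + 2 * \<gamma> + 3 > 0"
    using assms by (auto simp: admissible_def)
  then show ?thesis
    unfolding norm_const_def by (intro mult_pos_pos divide_pos_pos Gamma_real_pos) auto
qed

text \<open>
  The square of the twisting factor \<open>(x - y)^i (x + y)^j\<close> is absorbed by the weight, whose
  exponents \<open>2 \<alpha> + 1\<close> and \<open>2 \<beta> + 1\<close> grow by \<open>2 i\<close> and \<open>2 j\<close>. This shifts the
  parameters by \<open>(i, j)\<close>, and only the normalising constant has to be corrected.
\<close>

lemma weighted_inner_twisted_same:
  assumes [measurable]: "f \<in> borel_measurable borel" "g \<in> borel_measurable borel"
    and adm: "admissible \<alpha> \<beta> \<gamma>" "admissible (\<alpha> + real i) (\<beta> + real j) \<gamma>"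
  shows "weighted_inner unit_square (square_weight \<alpha> \<beta> \<gamma>) (twisted_pullback i j f) (twisted_pullback i j g) =
    norm_const \<alpha> \<beta> \<gamma> / norm_const (\<alpha> + real i) (\<beta> + real j) \<gamma> *
    weighted_inner Koornwinder_region (Koornwinder_weight (\<alpha> + real i) (\<beta> + real j) \<gamma>) f g"
proof -
  define c where "c = norm_const \<alpha> \<beta> \<gamma> / norm_const (\<alpha> + real i) (\<beta> + real j) \<gamma>"
  have c: "norm_const \<alpha> \<beta> \<gamma> = c * norm_const (\<alpha> + real i) (\<beta> + real j) \<gamma>"
    using norm_const_pos[OF adm(2)] by (simp add: c_def)
  have pw: "t ^ i * t ^ i * \<bar>t\<bar> powr (2 * a + 1) = \<bar>t\<bar> powr (2 * (a + real i) + 1)" for t a :: real and i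
  proof (cases "t = 0")
    case False
    then have "\<bar>t\<bar> powr (real (2 * i)) = \<bar>t\<bar> ^ (2 * i)"
      by (intro powr_realpow) simp
    also have "\<dots> = t ^ i * t ^ i"
      by (simp only: power_mult power2_abs) (simp only: power_mult[symmetric] mult_2 power_add)
    finally have "\<bar>t\<bar> powr (real (2 * i)) = t ^ i * t ^ i" .
    moreover have "2 * (a + real i) + 1 = real (2 * i) + (2 * a + 1)"
      by simp
    ultimately show ?thesis
      by (simp only: powr_add)
  qed simp
  have "twisted_pullback i j f z * twisted_pullback i j g z * square_weight \<alpha> \<beta> \<gamma> z =
      c * (f (folding_map z) * g (folding_map z) * square_weight (\<alpha> + real i) (\<beta> + real j) \<gamma> z)" for z
  proof (cases z)
    case (Pair x y)
    show ?thesis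
      by (simp only: Pair twisted_pullback_def square_weight_def prod.case pw[symmetric] c mult_ac)
  qed
  then show ?thesis
    using set_integral_pullback[of "\<lambda>z. f z * g z" "\<alpha> + real i" "\<beta> + real j" \<gamma>]
    by (simp add: weighted_inner_def c_def)
qed

lemma twisted_pullback_swap:
  "twisted_pullback i j f (prod.swap z) = (-1) ^ i * twisted_pullback i j f z"
proof (cases z)
  case (Pair x y)
  have "(y - x) ^ i = (-1) ^ i * (x - y) ^ i"
    by (simp add: power_mult_distrib[symmetric])
  moreover have "folding_map (y, x) = folding_map (x, y)"
    by (simp add: folding_map_def)
  ultimately show ?thesis
    by (simp add: Pair twisted_pullback_def add.commute)
qed

lemma twisted_pullback_swap_neg:
  "twisted_pullback i j f (- prod.swap z) = (-1) ^ j * twisted_pullback i j f z"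
proof (cases z)
  case (Pair x y)
  have "(- y + - x) ^ j = (-1 * (x + y)) ^ j"
    by (rule arg_cong[where f = "\<lambda>t. t ^ j"]) simp
  then have "(- y + - x) ^ j = (-1) ^ j * (x + y) ^ j"
    by (simp only: power_mult_distrib)
  moreover have "folding_map (- y, - x) = folding_map (x, y)"
    by (simp add: folding_map_def)
  moreover have "- y - - x = x - y"
    by simp
  ultimately show ?thesis
    by (simp only: Pair twisted_pullback_def prod.swap_def fst_conv snd_conv uminus_prod_def prod.case mult_ac)
qed

lemma square_weight_swap: "square_weight \<alpha> \<beta> \<gamma> (prod.swap z) = square_weight \<alpha> \<beta> \<gamma> z"
  by (cases z) (simp add: square_weight_def abs_minus_commute add.commute)

lemma square_weight_neg: "square_weight \<alpha> \<beta> \<gamma> (- z) = square_weight \<alpha> \<beta> \<gamma> z"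
proof (cases z)
  case (Pair x y)
  have "\<bar>- x - - y\<bar> = \<bar>x - y\<bar>" "\<bar>- x + - y\<bar> = \<bar>x + y\<bar>"
    by auto
  then show ?thesis
    by (simp only: Pair square_weight_def uminus_prod_def fst_conv snd_conv prod.case power2_minus)
qed

text \<open>
  Functions of different types are orthogonal by parity: the integrand changes sign under one
  of the two reflections, each of which preserves the square, its weight and Lebesgue measure.
\<close>

lemma weighted_inner_twisted_distinct:
  assumes [measurable]: "f \<in> borel_measurable borel" "g \<in> borel_measurable borel"
    and odd: "odd (i + i') \<or> odd (j + j')"
  shows "weighted_inner unit_square (square_weight \<alpha> \<beta> \<gamma>) (twisted_pullback i j f) (twisted_pullback i' j' g) = 0"
proof -
  define F where "F z = indicator unit_square z *
    (twisted_pullback i j f z * twisted_pullback i' j' g z * square_weight \<alpha> \<beta> \<gamma> z)" for z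
  have [measurable]: "F \<in> borel_measurable borel"
    unfolding F_def by measurable
  have [measurable]: "prod.swap \<in> borel_measurable (borel :: (real \<times> real) measure)"
    unfolding prod.swap_def by measurable
  have ind: "indicator unit_square (prod.swap z) = (indicator unit_square z :: real)"
    "indicator unit_square (- z) = (indicator unit_square z :: real)" for z
    by (cases z; auto simp: unit_square_def indicator_def)+
  have "F (prod.swap z) = (-1) ^ (i + i') * F z" "F (- prod.swap z) = (-1) ^ (j + j') * F z" for z
    by (simp_all only: F_def twisted_pullback_swap twisted_pullback_swap_neg square_weight_swap
          square_weight_neg ind power_add mult_ac)
  then have "(\<forall>z. F (prod.swap z) = - F z) \<or> (\<forall>z. F (- prod.swap z) = - F z)"
    using odd by (elim disjE) simp_all
  then have "(\<integral>z. F z \<partial>lborel) = 0"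
    using integral_eq_0_of_odd[OF _ _ lborel_distr_swap, of F]
      integral_eq_0_of_odd[OF _ _ lborel_distr_swap_neg, of F]
    by (elim disjE) simp_all
  then show ?thesis
    by (simp add: weighted_inner_def set_lebesgue_integral_def F_def)
qed

section \<open>Polynomials of bounded degree\<close>

lemma poly_space_monomial: "i + j \<le> n \<Longrightarrow> (\<lambda>(x, y). x ^ i * y ^ j) \<in> poly_space n"
  unfolding poly_space_def by (rule fun_space.span_base) auto

lemma poly_space_add: "f \<in> poly_space n \<Longrightarrow> g \<in> poly_space n \<Longrightarrow> (\<lambda>z. f z + g z) \<in> poly_space n"
  unfolding poly_space_def by (drule (1) fun_space.span_add) (simp add: plus_fun_def)

lemma poly_space_scale: "f \<in> poly_space n \<Longrightarrow> (\<lambda>z. c * f z) \<in> poly_space n"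
  unfolding poly_space_def by (rule fun_space.span_scale)

lemma poly_space_zero: "(\<lambda>z. 0) \<in> poly_space n"
  unfolding poly_space_def using fun_space.span_zero by (simp add: zero_fun_def)

lemma poly_space_mono: "f \<in> poly_space m \<Longrightarrow> m \<le> n \<Longrightarrow> f \<in> poly_space n"
  unfolding poly_space_def
  by (erule fun_space.span_mono[THEN subsetD, rotated]) (auto intro: order_trans)

lemma poly_space_cong: "f \<in> poly_space n \<Longrightarrow> (\<And>z. f z = g z) \<Longrightarrow> g \<in> poly_space n"
  using ext[of f g] by simp

lemma poly_space_induct [consumes 1, case_names zero add]:
  assumes "f \<in> poly_space n" "Q (\<lambda>z. 0)"
    and "\<And>c i j f. i + j \<le> n \<Longrightarrow> Q f \<Longrightarrow> Q (\<lambda>(x, y). c * (x ^ i * y ^ j) + f (x, y))"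
  shows "Q f"
  using assms(1) unfolding poly_space_def
proof (induction rule: fun_space.span_induct_alt)
  case base
  then show ?case
    using assms(2) by (simp add: zero_fun_def)
next
  case (step c x y)
  then obtain i j where "x = (\<lambda>(x, y). x ^ i * y ^ j)" "i + j \<le> n"
    by auto
  then show ?case
    using assms(3)[of i j y c] step by (simp add: plus_fun_def case_prod_unfold)
qed

lemma poly_space_mult:
  assumes "f \<in> poly_space m" "g \<in> poly_space n"
  shows "(\<lambda>z. f z * g z) \<in> poly_space (m + n)"
  using assms(1)
proof (induction rule: poly_space_induct)
  case zero
  then show ?case by (simp add: poly_space_zero)
next
  case (add c i j f)
  have "(\<lambda>(x, y). x ^ i * y ^ j * g (x, y)) \<in> poly_space (m + n)"
    using assms(2)
  proof (induction rule: poly_space_induct)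
    case zero
    then show ?case by (simp add: poly_space_zero case_prod_unfold)
  next
    case (add c' i' j' g)
    have "(\<lambda>(x, y). x ^ (i + i') * y ^ (j + j')) \<in> poly_space (m + n)"
      using add \<open>i + j \<le> m\<close> by (intro poly_space_monomial) simp
    from poly_space_add[OF poly_space_scale[OF this, of c'] add(2)] show ?case
      by (rule poly_space_cong) (auto simp only: prod.case power_add distrib_left mult_ac split: prod.splits)
  qed
  from poly_space_add[OF poly_space_scale[OF this, of c] add(2)] show ?case
    by (rule poly_space_cong) (auto simp only: prod.case distrib_left mult_ac split: prod.splits)
qed

lemma poly_space_const: "(\<lambda>z. c) \<in> poly_space n"
  using poly_space_scale[OF poly_space_monomial[of 0 0 n], of c] by (simp add: case_prod_unfold)

lemma poly_space_power:
  assumes "f \<in> poly_space m"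
  shows "(\<lambda>z. f z ^ k) \<in> poly_space (k * m)"
proof (induction k)
  case (Suc k)
  from poly_space_mult[OF assms Suc] show ?case by simp
qed (simp add: poly_space_const)

lemma poly_space_compose:
  assumes "f \<in> poly_space n" "p \<in> poly_space d" "q \<in> poly_space d"
  shows "(\<lambda>z. f (p z, q z)) \<in> poly_space (n * d)"
  using assms(1)
proof (induction rule: poly_space_induct)
  case (add c i j f)
  have "(\<lambda>z. p z ^ i * q z ^ j) \<in> poly_space (i * d + j * d)"
    by (intro poly_space_mult poly_space_power assms)
  then have "(\<lambda>z. p z ^ i * q z ^ j) \<in> poly_space (n * d)"
    using add(1) by (elim poly_space_mono) (simp flip: add_mult_distrib)
  from poly_space_add[OF poly_space_scale[OF this, of c] add(2)] show ?case
    by simp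
qed (simp add: poly_space_zero)

lemma poly_space_fst: "fst \<in> poly_space (Suc 0)" and poly_space_snd: "snd \<in> poly_space (Suc 0)"
  using poly_space_monomial[of 1 0 1] poly_space_monomial[of 0 1 1] by (simp_all add: case_prod_unfold)

lemma poly_space_diff:
  assumes "f \<in> poly_space n" "g \<in> poly_space n" shows "(\<lambda>z. f z - g z) \<in> poly_space n"
  using poly_space_add[OF assms(1) poly_space_scale[OF assms(2), of "-1"]] by simp

lemma poly_space_twisted_pullback:
  assumes "f \<in> poly_space n"
  shows "twisted_pullback i j f \<in> poly_space (i + j + 2 * n)"
proof -
  have "(\<lambda>z. 2 * fst z * snd z) \<in> poly_space 2"
    using poly_space_scale[OF poly_space_mult[OF poly_space_fst poly_space_snd], of 2]
    by (simp add: mult_ac numeral_2_eq_2)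
  moreover have "(\<lambda>z. (fst z)\<^sup>2 + (snd z)\<^sup>2 - 1) \<in> poly_space (2 * 1)"
    using poly_space_power[OF poly_space_fst, of 2] poly_space_power[OF poly_space_snd, of 2]
    by (intro poly_space_diff poly_space_add poly_space_const) auto
  ultimately have base: "(\<lambda>z. f (2 * fst z * snd z, (fst z)\<^sup>2 + (snd z)\<^sup>2 - 1)) \<in> poly_space (n * 2)"
    by (intro poly_space_compose assms) auto
  have "(\<lambda>z. fst z - snd z) \<in> poly_space 1" "(\<lambda>z. fst z + snd z) \<in> poly_space 1"
    using poly_space_fst poly_space_snd by (auto intro: poly_space_diff poly_space_add)
  then have twist: "(\<lambda>z. (fst z - snd z) ^ i * (fst z + snd z) ^ j) \<in> poly_space (i * 1 + j * 1)"
    by (intro poly_space_mult poly_space_power)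
  from poly_space_mult[OF twist base] show ?thesis
    by (simp add: twisted_pullback_def folding_map_def case_prod_unfold mult.commute)
qed

lemma continuous_on_poly_space:
  assumes "f \<in> poly_space n"
  shows "continuous_on S f"
  using assms
proof (induction rule: poly_space_induct)
  case (add c i j f)
  then show ?case
    unfolding case_prod_unfold by (auto intro!: continuous_intros)
qed auto

lemma borel_measurable_poly_space: "f \<in> poly_space n \<Longrightarrow> f \<in> borel_measurable borel"
  by (rule borel_measurable_continuous_onI) (rule continuous_on_poly_space)

section \<open>Graded orthonormal families are bases\<close>

text \<open>
  The condition under which the inner product is bilinear on polynomials: a Bochner
  integral of a non-integrable function is 0, so additivity needs integrability.
\<close>

definition finite_moments :: "(real \<times> real) set \<Rightarrow> (real \<times> real \<Rightarrow> real) \<Rightarrow> bool" where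
  "finite_moments D W \<longleftrightarrow> (\<forall>n. \<forall>f\<in>poly_space n. set_integrable lborel D (\<lambda>z. f z * W z))"

lemma finite_momentsI_compact:
  assumes W: "set_integrable lborel D W" and D: "compact D"
  shows "finite_moments D W"
  unfolding finite_moments_def
proof (intro allI ballI)
  fix n f assume f: "f \<in> poly_space n"
  have "compact (f ` D)"
    using continuous_on_poly_space[OF f] D by (rule compact_continuous_image)
  then have "bounded (f ` D)"
    by (rule compact_imp_bounded)
  then obtain C where "\<forall>y\<in>f ` D. norm y \<le> C"
    unfolding bounded_iff by blast
  then have C: "\<bar>f z\<bar> \<le> \<bar>C\<bar>" if "z \<in> D" for z
    using that by fastforce
  have [measurable]: "f \<in> borel_measurable borel"
    by (rule borel_measurable_poly_space[OF f])
  have dom: "integrable lborel (\<lambda>z. C * (indicator D z *\<^sub>R W z))"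
    using W unfolding set_integrable_def by (rule integrable_mult_right)
  have "(\<lambda>z. indicator D z *\<^sub>R W z) \<in> borel_measurable borel"
    using W by (auto simp: set_integrable_def dest: borel_measurable_integrable)
  then have meas: "(\<lambda>z. f z * (indicator D z *\<^sub>R W z)) \<in> borel_measurable lborel"
    by simp
  have "norm (f z * (indicator D z *\<^sub>R W z)) \<le> norm (C * (indicator D z *\<^sub>R W z))" for z
    using C[of z] by (cases "z \<in> D") (simp_all add: abs_mult mult_right_mono)
  then have "integrable lborel (\<lambda>z. f z * (indicator D z *\<^sub>R W z))"
    by (intro Bochner_Integration.integrable_bound[OF dom meas] always_eventually allI)
  moreover have "f z * (indicator D z *\<^sub>R W z) = indicator D z *\<^sub>R (f z * W z)" for z
    by simp
  ultimately show "set_integrable lborel D (\<lambda>z. f z * W z)"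
    by (simp only: set_integrable_def)
qed

lemma weighted_inner_commute: "weighted_inner D W f g = weighted_inner D W g f"
  by (simp add: weighted_inner_def mult_ac)

lemma weighted_inner_scale_left: "weighted_inner D W (\<lambda>z. c * f z) g = c * weighted_inner D W f g"
  by (simp add: weighted_inner_def mult.assoc)

lemma weighted_inner_zero_left: "weighted_inner D W 0 g = 0"
  by (simp add: weighted_inner_def set_lebesgue_integral_def)

lemma weighted_inner_add_left:
  assumes "finite_moments D W" "f \<in> poly_space n" "f' \<in> poly_space n" "g \<in> poly_space m"
  shows "weighted_inner D W (\<lambda>z. f z + f' z) g = weighted_inner D W f g + weighted_inner D W f' g"
proof -
  have "set_integrable lborel D (\<lambda>z. f z * g z * W z)" "set_integrable lborel D (\<lambda>z. f' z * g z * W z)"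
    using assms(1) poly_space_mult[OF assms(2,4)] poly_space_mult[OF assms(3,4)]
    by (simp_all add: finite_moments_def)
  then show ?thesis
    by (simp add: weighted_inner_def algebra_simps)
qed

lemma subspace_poly_space: "fun_space.subspace (poly_space n)"
  unfolding poly_space_def by (rule fun_space.subspace_span)

lemma subspace_orth_poly_space:
  assumes fm: "finite_moments D W"
  shows "fun_space.subspace (orth_poly_space D W n)"
proof (rule fun_space.subspaceI)
  show "0 \<in> orth_poly_space D W n"
    using fun_space.subspace_0[OF subspace_poly_space[of n]] weighted_inner_zero_left
    unfolding orth_poly_space_def by blast
next
  fix f g assume fg: "f \<in> orth_poly_space D W n" "g \<in> orth_poly_space D W n"
  then have poly: "f \<in> poly_space n" "g \<in> poly_space n"
    by (simp_all add: orth_poly_space_def)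
  have "weighted_inner D W (\<lambda>z. f z + g z) h = 0" if "m < n" "h \<in> poly_space m" for m h
    using weighted_inner_add_left[OF fm poly that(2)] fg that by (auto simp: orth_poly_space_def)
  then show "f + g \<in> orth_poly_space D W n"
    using poly_space_add[OF poly] by (simp add: orth_poly_space_def plus_fun_def)
next
  fix c f assume "f \<in> orth_poly_space D W n"
  then show "(\<lambda>z. c * f z) \<in> orth_poly_space D W n"
    by (simp add: orth_poly_space_def weighted_inner_scale_left poly_space_scale)
qed

lemma weighted_inner_sum_left:
  assumes fm: "finite_moments D W" and "finite B" "B \<subseteq> poly_space n" and g: "g \<in> poly_space m"
  shows "weighted_inner D W (\<Sum>v\<in>B. (\<lambda>z. u v * v z)) g = (\<Sum>v\<in>B. u v * weighted_inner D W v g)"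
  using assms(2,3)
proof (induction rule: finite_induct)
  case empty
  show ?case by (simp only: sum.empty weighted_inner_zero_left)
next
  case (insert w B)
  have "(\<Sum>v\<in>B. (\<lambda>z. u v * v z)) \<in> poly_space n"
    using insert.prems by (intro fun_space.subspace_sum[OF subspace_poly_space] poly_space_scale) auto
  then have "weighted_inner D W (\<lambda>z. u w * w z + (\<Sum>v\<in>B. (\<lambda>z. u v * v z)) z) g =
      weighted_inner D W (\<lambda>z. u w * w z) g + weighted_inner D W (\<Sum>v\<in>B. (\<lambda>z. u v * v z)) g"
    using insert.prems by (intro weighted_inner_add_left[OF fm _ _ g] poly_space_scale) auto
  then show ?case
    using insert by (simp add: weighted_inner_scale_left plus_fun_def)
qed

text \<open>
  A monomial is determined by its degree \<open>d \<le> n\<close> and its first exponent \<open>i \<le> d\<close>.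
\<close>

lemma monomials_card_le:
  shows "finite {(\<lambda>(x, y). x ^ i * y ^ j :: real) | i j :: nat. i + j \<le> n}" (is "finite ?M")
    and "card {(\<lambda>(x, y). x ^ i * y ^ j :: real) | i j :: nat. i + j \<le> n} \<le> (\<Sum>d\<le>n. d + 1)"
proof -
  let ?K = "Sigma {..n} (\<lambda>d. {..d})"
  have M: "?M \<subseteq> (\<lambda>(d, i). (\<lambda>(x, y). x ^ i * y ^ (d - i))) ` ?K"
  proof safe
    fix i j :: nat assume "i + j \<le> n"
    then show "(\<lambda>(x, y). x ^ i * y ^ j :: real) \<in> (\<lambda>(d, i). (\<lambda>(x, y). x ^ i * y ^ (d - i))) ` ?K"
      by (intro image_eqI[of _ _ "(i + j, i)"]) auto
  qed
  then show "finite ?M"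
    by (rule finite_subset) auto
  have "card ?M \<le> card ?K"
    using M by (rule surj_card_le[rotated]) auto
  then show "card ?M \<le> (\<Sum>d\<le>n. d + 1)"
    by simp
qed

lemma (in vector_space) span_eq_if_card_ge:
  assumes "independent B" "B \<subseteq> span S" "finite S" "card S \<le> card B"
  shows "span B = span S"
proof (rule ccontr)
  assume "span B \<noteq> span S"
  moreover have "span B \<subseteq> span S"
    using assms(2) by (rule span_minimal) (rule subspace_span)
  ultimately obtain v where v: "v \<in> span S" "v \<notin> span B"
    by blast
  then have "independent (insert v B)"
    using assms(1) by (intro independent_insertI)
  then have "card (insert v B) \<le> card S"
    using assms v independent_span_bound[of S "insert v B"] by auto
  moreover have "finite B" "v \<notin> B"
    using assms independent_span_bound[of S B] v span_base by auto
  ultimately show False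
    using assms(4) by simp
qed

lemma orthonormal_inj_independent:
  assumes fm: "finite_moments D W" and K: "finite K" and e: "\<And>k. k \<in> K \<Longrightarrow> e k \<in> poly_space n"
    and on: "\<And>k l. k \<in> K \<Longrightarrow> l \<in> K \<Longrightarrow> weighted_inner D W (e k) (e l) = (if k = l then 1 else 0)"
  shows "inj_on e K" and "fun_space.independent (e ` K)"
proof -
  show inj: "inj_on e K"
    using on by (intro inj_onI) (metis zero_neq_one)
  show "fun_space.independent (e ` K)"
  proof (rule fun_space.independent_if_scalars_zero)
    show "finite (e ` K)"
      using K by simp
  next
    fix u w assume 0: "(\<Sum>v\<in>e ` K. (\<lambda>z. u v * v z)) = 0" and "w \<in> e ` K"
    then obtain l where l: "l \<in> K" "w = e l"
      by auto
    have "0 = weighted_inner D W (\<Sum>v\<in>e ` K. (\<lambda>z. u v * v z)) w"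
      unfolding 0 by (simp add: weighted_inner_zero_left)
    also have "\<dots> = (\<Sum>v\<in>e ` K. u v * weighted_inner D W v w)"
      using K e l by (intro weighted_inner_sum_left[OF fm, of _ n _ n]) auto
    also have "\<dots> = (\<Sum>k\<in>K. if k = l then u (e k) else 0)"
      using inj on l by (auto simp: sum.reindex intro!: sum.cong)
    also have "\<dots> = u w"
      using K l by simp
    finally show "u w = 0"
      by simp
  qed
qed

text \<open>
  A dimension count. The members of degree at most \<open>n\<close> are orthonormal, hence independent, and
  there are \<open>\<Sum>d\<le>n. d + 1\<close> of them, as many as monomials of degree at most \<open>n\<close>; so they span all
  polynomials of that degree. Expanding a polynomial in this basis, its coefficients are its inner
  products with the members, and orthogonality to all lower degrees leaves exactly the members of
  degree \<open>n\<close>.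
\<close>

lemma orthonormal_basis_of_graded_family:
  fixes e :: "nat \<Rightarrow> 'i \<Rightarrow> real \<times> real \<Rightarrow> real"
  assumes fm: "finite_moments D W"
    and I: "\<And>n. finite (I n)" "\<And>n. card (I n) = n + 1"
    and e: "\<And>n i. i \<in> I n \<Longrightarrow> e n i \<in> poly_space n"
    and on: "\<And>n m i j. i \<in> I n \<Longrightarrow> j \<in> I m \<Longrightarrow>
      weighted_inner D W (e n i) (e m j) = (if n = m \<and> i = j then 1 else 0)"
  shows "orthonormal_basis D W (orth_poly_space D W n) (I n) (e n)"
proof -
  (* The members of degree at most n. *)
  define B where "B n = (\<lambda>(m, i). e m i) ` Sigma {..n} I" for n
  have B_poly: "B n \<subseteq> poly_space n" for n
    using e poly_space_mono by (fastforce simp: B_def)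
  have B_finite: "finite (B n)" for n
    unfolding B_def using I by (intro finite_imageI finite_SigmaI) auto
  have B_span: "fun_space.span (B n) = poly_space n" for n
  proof -
    have *: "inj_on (\<lambda>(m, i). e m i) (Sigma {..n} I)" "fun_space.independent (B n)"
      unfolding B_def using I e on poly_space_mono
      by (intro orthonormal_inj_independent[OF fm, of _ _ n]; fastforce)+
    have "card (B n) = (\<Sum>d\<le>n. d + 1)"
      unfolding B_def card_image[OF *(1)] by (simp add: I)
    then show ?thesis
      using monomials_card_le[of n] * B_poly
      unfolding poly_space_def by (intro fun_space.span_eq_if_card_ge) auto
  qed
  have expand: "\<exists>u. f = (\<Sum>v\<in>B n. (\<lambda>z. u v * v z)) \<and>
      (\<forall>m i. m \<le> n \<longrightarrow> i \<in> I m \<longrightarrow> weighted_inner D W f (e m i) = u (e m i))" if f: "f \<in> poly_space n" for f n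
  proof -
    obtain u where u: "f = (\<Sum>v\<in>B n. (\<lambda>z. u v * v z))"
      using f unfolding B_span[symmetric] fun_space.span_finite[OF B_finite] by blast
    have "weighted_inner D W f (e m i) = u (e m i)" if mi: "m \<le> n" "i \<in> I m" for m i
    proof -
      have "weighted_inner D W f (e m i) = (\<Sum>v\<in>B n. u v * weighted_inner D W v (e m i))"
        unfolding u using B_finite B_poly e mi by (intro weighted_inner_sum_left[OF fm]) auto
      also have "\<dots> = (\<Sum>v\<in>B n. if v = e m i then u v else 0)"
      proof (intro sum.cong refl)
        fix v assume "v \<in> B n"
        then obtain a b where ab: "b \<in> I a" "v = e a b"
          by (auto simp: B_def)
        show "u v * weighted_inner D W v (e m i) = (if v = e m i then u v else 0)"
          using on[OF ab(1) mi(2)] on[OF mi(2) mi(2)] ab(2) by (auto split: if_splits)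
      qed
      also have "\<dots> = u (e m i)"
        using B_finite mi by (auto simp: B_def)
      finally show ?thesis .
    qed
    with u show ?thesis by blast
  qed
  have "fun_space.span (e n ` I n) = orth_poly_space D W n"
  proof (intro equalityI fun_space.span_minimal subspace_orth_poly_space[OF fm] subsetI)
    fix f assume "f \<in> e n ` I n"
    then obtain i where i: "i \<in> I n" "f = e n i"
      by auto
    have "weighted_inner D W f g = 0" if mn: "m < n" and g: "g \<in> poly_space m" for m g
    proof -
      obtain u where u: "g = (\<Sum>v\<in>B m. (\<lambda>z. u v * v z))"
        using expand[OF g] by blast
      have "weighted_inner D W g f = (\<Sum>v\<in>B m. u v * weighted_inner D W v f)"
        unfolding u using B_finite B_poly e i by (intro weighted_inner_sum_left[OF fm]) auto
      also have "\<dots> = 0"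
        using mn i by (intro sum.neutral) (auto simp: B_def on)
      finally show ?thesis
        by (simp add: weighted_inner_commute)
    qed
    then show "f \<in> orth_poly_space D W n"
      using e i by (auto simp: orth_poly_space_def)
  next
    fix f assume f: "f \<in> orth_poly_space D W n"
    then obtain u where u: "f = (\<Sum>v\<in>B n. (\<lambda>z. u v * v z))"
      and u_eq: "\<And>m i. m \<le> n \<Longrightarrow> i \<in> I m \<Longrightarrow> weighted_inner D W f (e m i) = u (e m i)"
      using expand[of f n] by (auto simp: orth_poly_space_def)
    show "f \<in> fun_space.span (e n ` I n)"
      unfolding u
    proof (rule fun_space.span_sum)
      fix v assume "v \<in> B n"
      then obtain m i where mi: "m \<le> n" "i \<in> I m" "v = e m i"
        by (auto simp: B_def)
      show "(\<lambda>z. u v * v z) \<in> fun_space.span (e n ` I n)"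
      proof (cases "m = n")
        case True
        with mi show ?thesis
          by (intro fun_space.span_scale fun_space.span_base) auto
      next
        case False
        with mi have "m < n"
          by simp
        with f e[OF mi(2)] mi(3) have "weighted_inner D W f v = 0"
          by (simp add: orth_poly_space_def)
        with u_eq mi have "u v = 0"
          by simp
        then show ?thesis
          using fun_space.span_zero by (simp add: zero_fun_def)
      qed
    qed
  qed
  moreover have "inj_on (e n) (I n)" "fun_space.independent (e n ` I n)"
    using I e on by (intro orthonormal_inj_independent[OF fm, of _ _ n]; simp)+
  ultimately show ?thesis
    using on by (simp add: orthonormal_basis_def)
qed

section \<open>Transferring the basis\<close>

lemma poly_space_0_const: "f \<in> poly_space 0 \<Longrightarrow> \<exists>c. f = (\<lambda>z. c)"
proof (induction rule: poly_space_induct)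
  case (add c i j f)
  then show ?case
    by (auto simp: case_prod_unfold)
qed auto

definition Koornwinder_orthonormal :: "basis_family \<Rightarrow> bool" where
  "Koornwinder_orthonormal P \<longleftrightarrow> (\<forall>\<alpha> \<beta> \<gamma> m. admissible \<alpha> \<beta> \<gamma> \<longrightarrow>
     orthonormal_basis Koornwinder_region (Koornwinder_weight \<alpha> \<beta> \<gamma>)
       (orth_poly_space Koornwinder_region (Koornwinder_weight \<alpha> \<beta> \<gamma>) m)
       {0..m} (\<lambda>k. P \<alpha> \<beta> \<gamma> k m))"

lemma Koornwinder_orthonormalD:
  assumes "Koornwinder_orthonormal P" "admissible \<alpha> \<beta> \<gamma>" "k \<le> m"
  shows "P \<alpha> \<beta> \<gamma> k m \<in> orth_poly_space Koornwinder_region (Koornwinder_weight \<alpha> \<beta> \<gamma>) m"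
    and "l \<le> m \<Longrightarrow> weighted_inner Koornwinder_region (Koornwinder_weight \<alpha> \<beta> \<gamma>)
          (P \<alpha> \<beta> \<gamma> k m) (P \<alpha> \<beta> \<gamma> l m) = (if k = l then 1 else 0)"
proof -
  have "orthonormal_basis Koornwinder_region (Koornwinder_weight \<alpha> \<beta> \<gamma>)
       (orth_poly_space Koornwinder_region (Koornwinder_weight \<alpha> \<beta> \<gamma>) m)
       {0..m} (\<lambda>k. P \<alpha> \<beta> \<gamma> k m)"
    using assms by (simp add: Koornwinder_orthonormal_def)
  then show "P \<alpha> \<beta> \<gamma> k m \<in> orth_poly_space Koornwinder_region (Koornwinder_weight \<alpha> \<beta> \<gamma>) m"
    "l \<le> m \<Longrightarrow> weighted_inner Koornwinder_region (Koornwinder_weight \<alpha> \<beta> \<gamma>)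
          (P \<alpha> \<beta> \<gamma> k m) (P \<alpha> \<beta> \<gamma> l m) = (if k = l then 1 else 0)"
    using assms(3) fun_space.span_base[of "P \<alpha> \<beta> \<gamma> k m" "(\<lambda>k. P \<alpha> \<beta> \<gamma> k m) ` {0..m}"]
    unfolding orthonormal_basis_def by auto
qed

lemma Koornwinder_orthonormal_poly:
  assumes "Koornwinder_orthonormal P" "admissible \<alpha> \<beta> \<gamma>" "k \<le> m"
  shows "P \<alpha> \<beta> \<gamma> k m \<in> poly_space m"
  using Koornwinder_orthonormalD(1)[OF assms] by (simp add: orth_poly_space_def)

text \<open>
  Within one degree this is orthonormality; across degrees it holds because a basis polynomial is
  orthogonal to every polynomial of lower degree.
\<close>

lemma Koornwinder_orthonormal_graded:
  assumes P: "Koornwinder_orthonormal P" "admissible \<alpha> \<beta> \<gamma>" and k: "k \<le> m" and l: "l \<le> m'"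
  shows "weighted_inner Koornwinder_region (Koornwinder_weight \<alpha> \<beta> \<gamma>)
      (P \<alpha> \<beta> \<gamma> k m) (P \<alpha> \<beta> \<gamma> l m') = (if k = l \<and> m = m' then 1 else 0)"
proof (cases m m' rule: linorder_cases)
  case less
  then show ?thesis
    using Koornwinder_orthonormalD(1)[OF P l] Koornwinder_orthonormal_poly[OF P k]
    by (subst weighted_inner_commute) (auto simp: orth_poly_space_def)
next
  case equal
  then show ?thesis
    using Koornwinder_orthonormalD(2)[OF P k, of l] l by simp
next
  case greater
  then show ?thesis
    using Koornwinder_orthonormalD(1)[OF P k] Koornwinder_orthonormal_poly[OF P l]
    by (auto simp: orth_poly_space_def)
qed

text \<open>
  Integrability of the weight can be read off from the existence of the basis in degree 0: its only
  member is a constant of norm 1, while a non-integrable weight would give it norm 0.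
\<close>

lemma set_integrable_Koornwinder_weight:
  assumes P: "Koornwinder_orthonormal P" and adm: "admissible \<alpha> \<beta> \<gamma>"
  shows "set_integrable lborel Koornwinder_region (Koornwinder_weight \<alpha> \<beta> \<gamma>)"
proof -
  obtain c where c: "P \<alpha> \<beta> \<gamma> 0 0 = (\<lambda>z. c)"
    using poly_space_0_const Koornwinder_orthonormal_poly[OF P adm, of 0 0] by blast
  have one: "set_lebesgue_integral lborel Koornwinder_region (\<lambda>z. c * c * Koornwinder_weight \<alpha> \<beta> \<gamma> z) = 1"
    using Koornwinder_orthonormalD(2)[OF P adm, of 0 0 0] by (simp add: c weighted_inner_def)
  then have "set_integrable lborel Koornwinder_region (\<lambda>z. c * c * Koornwinder_weight \<alpha> \<beta> \<gamma> z)"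
    unfolding set_lebesgue_integral_def set_integrable_def
    by (rule contrapos_pp) (simp add: not_integrable_integral_eq)
  moreover have "c \<noteq> 0"
    using one by (auto simp: set_lebesgue_integral_def)
  ultimately show ?thesis
    by simp
qed

lemma finite_moments_square:
  assumes "Koornwinder_orthonormal P" "admissible \<alpha> \<beta> \<gamma>"
  shows "finite_moments unit_square (square_weight \<alpha> \<beta> \<gamma>)"
proof (rule finite_momentsI_compact)
  show "set_integrable lborel unit_square (square_weight \<alpha> \<beta> \<gamma>)"
    using set_integrable_pullback[of "\<lambda>z. 1" \<alpha> \<beta> \<gamma>] set_integrable_Koornwinder_weight[OF assms] by simp
  show "compact unit_square"
    unfolding unit_square_def by (intro compact_Times compact_Icc)
qed

text \<open>
  The common form of the four families: the types \<open>(i, j) = (0, 0), (1, 1)\<close> give the even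
  degrees, \<open>(0, 1), (1, 0)\<close> the odd ones.
\<close>

definition square_poly :: "nat \<Rightarrow> nat \<Rightarrow> basis_family \<Rightarrow> basis_family" where
  "square_poly i j P \<alpha> \<beta> \<gamma> k m =
     (\<lambda>z. b_const i j \<alpha> \<beta> \<gamma> * twisted_pullback i j (P (\<alpha> + real i) (\<beta> + real j) \<gamma> k m) z)"

lemma admissible_shift: "admissible \<alpha> \<beta> \<gamma> \<Longrightarrow> admissible (\<alpha> + real i) (\<beta> + real j) \<gamma>"
  by (auto simp: admissible_def)

lemma square_poly_in_poly_space:
  assumes "Koornwinder_orthonormal P" "admissible \<alpha> \<beta> \<gamma>" "k \<le> m"
  shows "square_poly i j P \<alpha> \<beta> \<gamma> k m \<in> poly_space (i + j + 2 * m)"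
  unfolding square_poly_def
  using assms by (intro poly_space_scale poly_space_twisted_pullback Koornwinder_orthonormal_poly admissible_shift)

text \<open>
  Different types are orthogonal by parity. Within one type the inner product is that of the
  basis with shifted parameters times the quotient of the normalising constants, which is what the
  factor \<open>b_const i j\<close> compensates.
\<close>

lemma square_poly_orthonormal:
  assumes P: "Koornwinder_orthonormal P" and adm: "admissible \<alpha> \<beta> \<gamma>" and k: "k \<le> m" and l: "l \<le> m'"
    and ij: "i \<le> 1" "j \<le> 1" "i' \<le> 1" "j' \<le> 1"
  shows "weighted_inner unit_square (square_weight \<alpha> \<beta> \<gamma>)
      (square_poly i j P \<alpha> \<beta> \<gamma> k m) (square_poly i' j' P \<alpha> \<beta> \<gamma> l m') =
    (if i = i' \<and> j = j' \<and> k = l \<and> m = m' then 1 else 0)"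
proof -
  let ?f = "P (\<alpha> + real i) (\<beta> + real j) \<gamma> k m" and ?g = "P (\<alpha> + real i') (\<beta> + real j') \<gamma> l m'"
  have adm': "admissible (\<alpha> + real i) (\<beta> + real j) \<gamma>" "admissible (\<alpha> + real i') (\<beta> + real j') \<gamma>"
    using adm by (auto intro: admissible_shift)
  have meas: "?f \<in> borel_measurable borel" "?g \<in> borel_measurable borel"
    using Koornwinder_orthonormal_poly[OF P adm'(1) k] Koornwinder_orthonormal_poly[OF P adm'(2) l]
    by (simp_all add: borel_measurable_poly_space)
  have "weighted_inner unit_square (square_weight \<alpha> \<beta> \<gamma>)
      (square_poly i j P \<alpha> \<beta> \<gamma> k m) (square_poly i' j' P \<alpha> \<beta> \<gamma> l m') =
    b_const i j \<alpha> \<beta> \<gamma> * (b_const i' j' \<alpha> \<beta> \<gamma> *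
      weighted_inner unit_square (square_weight \<alpha> \<beta> \<gamma>) (twisted_pullback i j ?f) (twisted_pullback i' j' ?g))"
    unfolding square_poly_def
    by (subst weighted_inner_scale_left, subst (1 2) weighted_inner_commute, subst weighted_inner_scale_left) simp
  also have "\<dots> = (if i = i' \<and> j = j' \<and> k = l \<and> m = m' then 1 else 0)"
  proof (cases "i = i' \<and> j = j'")
    case True
    have "b_const i j \<alpha> \<beta> \<gamma> * b_const i j \<alpha> \<beta> \<gamma> = norm_const (\<alpha> + real i) (\<beta> + real j) \<gamma> / norm_const \<alpha> \<beta> \<gamma>"
      using norm_const_pos[OF adm] norm_const_pos[OF adm'(1)] by (simp add: b_const_def)
    then show ?thesis
      using True norm_const_pos[OF adm] norm_const_pos[OF adm'(1)]
        Koornwinder_orthonormal_graded[OF P adm'(1) k l]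
        weighted_inner_twisted_same[OF meas(1) _ adm adm'(1), of ?g] meas(2)
      by (simp add: mult.assoc[symmetric])
  next
    case False
    then have "odd (i + i') \<or> odd (j + j')"
      using ij by (auto simp: le_Suc_eq)
    with False show ?thesis
      using weighted_inner_twisted_distinct[OF meas] by auto
  qed
  finally show ?thesis .
qed

text \<open>
  Both parities at once: for \<open>N = 2 n\<close> there are \<open>n + 1\<close> and \<open>n\<close> indices, for \<open>N = 2 n + 1\<close>
  there are \<open>n + 1\<close> and \<open>n + 1\<close>; in either case \<open>N + 1\<close> in total.
\<close>

definition square_index :: "nat \<Rightarrow> (nat + nat) set" where
  "square_index N = {0..N div 2} <+> {0..<(N + 1) div 2}"

text \<open>
  The type \<open>(i, j)\<close>, the index \<open>k\<close> and the degree \<open>m\<close> on the region belonging to a position in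
  degree \<open>N\<close>. As \<open>N = i + j + 2 m\<close>, a label determines its degree and its position, so that
  orthonormality across all degrees reduces to comparing labels. In degree 0 the truncated
  \<open>N div 2 - 1\<close> is harmless, because there is no position \<open>Inr k\<close>.
\<close>

definition square_label :: "nat \<Rightarrow> nat + nat \<Rightarrow> nat \<times> nat \<times> nat \<times> nat" where
  "square_label N x =
     (if even N
      then case x of Inl k \<Rightarrow> (0, 0, k, N div 2) | Inr k \<Rightarrow> (1, 1, k, N div 2 - 1)
      else case x of Inl k \<Rightarrow> (0, 1, k, N div 2) | Inr k \<Rightarrow> (1, 0, k, N div 2))"

definition square_family ::
  "basis_family \<Rightarrow> real \<Rightarrow> real \<Rightarrow> real \<Rightarrow> nat \<Rightarrow> nat + nat \<Rightarrow> real \<times> real \<Rightarrow> real" where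
  "square_family P \<alpha> \<beta> \<gamma> N x = (case square_label N x of (i, j, k, m) \<Rightarrow> square_poly i j P \<alpha> \<beta> \<gamma> k m)"

lemma square_label_bounds:
  assumes "x \<in> square_index N" "square_label N x = (i, j, k, m)"
  shows "i \<le> 1" "j \<le> 1" "k \<le> m" "i + j + 2 * m = N"
proof -
  have "i \<le> 1 \<and> j \<le> 1 \<and> k \<le> m \<and> i + j + 2 * m = N"
  proof (cases "even N")
    case True
    then obtain n where "N = 2 * n" ..
    with assms show ?thesis
      by (auto simp: square_label_def square_index_def)
  next
    case False
    then obtain n where "N = 2 * n + 1" ..
    with assms show ?thesis
      by (auto simp: square_label_def square_index_def)
  qed
  then show "i \<le> 1" "j \<le> 1" "k \<le> m" "i + j + 2 * m = N"
    by auto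
qed

lemma square_label_inj:
  assumes "x \<in> square_index N" "y \<in> square_index M" "square_label N x = square_label M y"
  shows "N = M \<and> x = y"
proof -
  obtain i j k m where l: "square_label N x = (i, j, k, m)"
    by (cases "square_label N x")
  with assms have "N = M"
    using square_label_bounds(4)[of x N i j k m] square_label_bounds(4)[of y M i j k m] by simp
  with assms(3) show ?thesis
    by (auto simp: square_label_def split: if_splits sum.splits)
qed

lemma orthonormal_basis_square_family:
  assumes P: "Koornwinder_orthonormal P" and adm: "admissible \<alpha> \<beta> \<gamma>"
  shows "orthonormal_basis unit_square (square_weight \<alpha> \<beta> \<gamma>)
    (orth_poly_space unit_square (square_weight \<alpha> \<beta> \<gamma>) N) (square_index N) (square_family P \<alpha> \<beta> \<gamma> N)"
proof (rule orthonormal_basis_of_graded_family)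
  show "finite_moments unit_square (square_weight \<alpha> \<beta> \<gamma>)"
    using P adm by (rule finite_moments_square)
  show "finite (square_index n)" "card (square_index n) = n + 1" for n
    by (simp_all add: square_index_def card_Plus)
  show "square_family P \<alpha> \<beta> \<gamma> n x \<in> poly_space n" if x: "x \<in> square_index n" for n x
  proof -
    obtain i j k m where l: "square_label n x = (i, j, k, m)"
      by (cases "square_label n x")
    then show ?thesis
      using square_poly_in_poly_space[OF P adm, of k m i j] square_label_bounds[OF x l]
      by (simp add: square_family_def)
  qed
  show "weighted_inner unit_square (square_weight \<alpha> \<beta> \<gamma>)
      (square_family P \<alpha> \<beta> \<gamma> n x) (square_family P \<alpha> \<beta> \<gamma> m y) = (if n = m \<and> x = y then 1 else 0)"
    if x: "x \<in> square_index n" and y: "y \<in> square_index m" for n m x y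
  proof -
    obtain i j k d where l: "square_label n x = (i, j, k, d)"
      by (cases "square_label n x")
    obtain i' j' k' d' where l': "square_label m y = (i', j', k', d')"
      by (cases "square_label m y")
    have "weighted_inner unit_square (square_weight \<alpha> \<beta> \<gamma>)
        (square_family P \<alpha> \<beta> \<gamma> n x) (square_family P \<alpha> \<beta> \<gamma> m y) =
      (if i = i' \<and> j = j' \<and> k = k' \<and> d = d' then 1 else 0)"
      using square_poly_orthonormal[OF P adm, of k d k' d' i j i' j']
        square_label_bounds[OF x l] square_label_bounds[OF y l']
      by (simp add: square_family_def l l')
    also have "i = i' \<and> j = j' \<and> k = k' \<and> d = d' \<longleftrightarrow> n = m \<and> x = y"
      using square_label_inj[OF x y] l l' by auto
    finally show ?thesis .
  qed
qed

theorem theorem4p4: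
  fixes P :: "real \<Rightarrow> real \<Rightarrow> real \<Rightarrow> nat \<Rightarrow> nat \<Rightarrow> real \<times> real \<Rightarrow> real"
    and \<alpha> \<beta> \<gamma> :: real and n :: nat
  assumes P: "\<And>\<alpha>' \<beta>' \<gamma>' m. admissible \<alpha>' \<beta>' \<gamma>' \<Longrightarrow>
      orthonormal_basis Koornwinder_region (Koornwinder_weight \<alpha>' \<beta>' \<gamma>')
        (orth_poly_space Koornwinder_region (Koornwinder_weight \<alpha>' \<beta>' \<gamma>') m)
        {0..m} (\<lambda>k. P \<alpha>' \<beta>' \<gamma>' k m)"
    and adm: "admissible \<alpha> \<beta> \<gamma>"
  shows "orthonormal_basis unit_square (square_weight \<alpha> \<beta> \<gamma>)
      (orth_poly_space unit_square (square_weight \<alpha> \<beta> \<gamma>) (2 * n))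
      ({0..n} <+> {0..<n})
      (case_sum (\<lambda>k. Q1_even P \<alpha> \<beta> \<gamma> k n) (\<lambda>k. Q2_even P \<alpha> \<beta> \<gamma> k n))
    \<and> orthonormal_basis unit_square (square_weight \<alpha> \<beta> \<gamma>)
      (orth_poly_space unit_square (square_weight \<alpha> \<beta> \<gamma>) (2 * n + 1))
      ({0..n} <+> {0..n})
      (case_sum (\<lambda>k. Q1_odd P \<alpha> \<beta> \<gamma> k n) (\<lambda>k. Q2_odd P \<alpha> \<beta> \<gamma> k n))"
proof -
  have ortho: "Koornwinder_orthonormal P"
    using P by (simp add: Koornwinder_orthonormal_def)
  have b00: "b_const 0 0 \<alpha> \<beta> \<gamma> = 1"
    using norm_const_pos[OF adm] by (simp add: b_const_def)
  have diff_squares: "(x - y) * (x + y) = x\<^sup>2 - y\<^sup>2" for x y :: real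
    by (simp add: power2_eq_square algebra_simps)
  have "square_family P \<alpha> \<beta> \<gamma> (2 * n) =
      case_sum (\<lambda>k. Q1_even P \<alpha> \<beta> \<gamma> k n) (\<lambda>k. Q2_even P \<alpha> \<beta> \<gamma> k n)"
    by (intro ext) (auto simp: square_family_def square_label_def square_poly_def twisted_pullback_def
        folding_map_def Q1_even_def Q2_even_def b00 diff_squares split: sum.splits)
  moreover have "square_index (2 * n) = {0..n} <+> {0..<n}"
    by (simp add: square_index_def)
  moreover have "square_family P \<alpha> \<beta> \<gamma> (2 * n + 1) =
      case_sum (\<lambda>k. Q1_odd P \<alpha> \<beta> \<gamma> k n) (\<lambda>k. Q2_odd P \<alpha> \<beta> \<gamma> k n)"
    by (intro ext) (auto simp: square_family_def square_label_def square_poly_def twisted_pullback_def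
        folding_map_def Q1_odd_def Q2_odd_def split: sum.splits)
  moreover have "square_index (2 * n + 1) = {0..n} <+> {0..n}"
    by (simp add: square_index_def atLeastLessThanSuc_atLeastAtMost)
  ultimately show ?thesis
    using orthonormal_basis_square_family[OF ortho adm, of "2 * n"]
      orthonormal_basis_square_family[OF ortho adm, of "2 * n + 1"]
    by simp
qed

end
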